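(* For every weight $\kappa=(k_\sigma)_\sigma\in\mathbb{Z}[I]$, every type $\nu=(r_\sigma)_\sigma\in\mathbb{Z}_{\ge0}[I]$ and every $\sigma\in I$, the operator $\nabla_\sigma$ is the analog of the Maass–Shimura operator $D_\kappa^\sigma$, in the sense that $$D_\kappa^\sigma\circ\phi=\phi\circ\nabla_\sigma$$ as maps on $H^0(X,\mathcal{V}_\kappa^\nu)$, where $\phi$ is the realization map from geometric nearly holomorphic Hilbert modular forms to $C^\infty$ functions on $\mathfrak{h}_F$ defined in the context.
   Context: $F$ is a totally real field of degree $d>1$, $I$ its set of real embeddings, $N\ge5$, $\Gamma=\Gamma_1(N)\subset\mathrm{SL}_2(\mathcal{O}_F)$. Put $\mathbb{T}=\operatorname{Res}_{\mathcal{O}_F/\mathbb{Z}}\mathbb{G}_m$, so $\mathbb{T}(\mathbb{C})=\prod_\sigma\mathbb{C}^\times$; $G=\operatorname{Res}_{\mathcal{O}_F/\mathbb{Z}}\mathrm{GL}_2$ with upper triangular Borel $Q$; $\mathfrak{g}=\operatorname{Lie}G$, $\mathfrak{q}=\operatorname{Lie}Q$. For $\kappa=(k_\sigma)_\sigma$ and $t\in\mathbb{T}(\mathbb{C})$, $\kappa(t)=\prod_\sigma t_\sigma^{k_\sigma}$; $\kappa+2\sigma$ is the tuple with $k_\sigma$ replaced by $k_\sigma+2$. **Geometry over $\mathbb{C}$.** $Y$ is the moduli space of polarized Hilbert–Blumenthal abelian varieties $(A,\iota,\psi,\lambda)$ ($A$ of dimension $d$, $\iota\colon\mathcal{O}_F\to\operatorname{End}A$,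 $\psi\colon\mu_N\otimes\mathcal{D}_F^{-1}\hookrightarrow A$, $\lambda$ a polarization of the fixed type for which $\Gamma\backslash\mathfrak{h}_F\cong Y(\mathbb{C})$ via $\underline{z}\mapsto A_{\underline{z}}$ below), $X$ a projective toroidal compactification with boundary $C$, $\pi\colon\mathcal{A}\to X$ the universal (semi-abelian) object, $\underline{\omega}=\pi_*\Omega^1_{\mathcal{A}/X}=\bigoplus_\sigma\underline{\omega}_\sigma$, and $\mathcal{H}=\bigoplus_\sigma\mathcal{H}_\sigma$ the canonical extension of $H^1_{dR}(\mathcal{A}/Y)$, with Hodge filtration $0\to\underline{\omega}\to\mathcal{H}\to\underline{\omega}^\vee\to0$ and Gauss–Manin connection $\nabla\colon\mathcal{H}\to\mathcal{H}\otimes\Omega^1_X(\log C)$. $T^{\times,+}_{\mathcal{H}}=\operatorname{Isom}^+_{X,F}([\mathcal{O}_F\otimes\mathcal{O}_X]^{\oplus2},\mathcal{H})$ is the $Q$-torsor of $\mathcal{O}_F$-linear frames taking the first summand onto $\underline{\omega}$. $\mathrm{KS}\colon\Omega^1_X(\log C)\cong\bigoplus_\sigma\underline{\omega}_\sigma^{\otimes2}$ is the Kodaira–Spencer isomorphism, induced by $\nabla$ and the identification $\mathcal{H}/\underline{\omega}\cong\underline{\omega}^\vee$ given by the polarization pairing, normalized so that (with $\mathrm{d}w_\sigma$ as below) it sends $\mathrm{d}z_\sigma$ to $\mathrm{d}w_\sigma^{\otimes2}$; $\mathrm{KS}_\sigma$ is its component in $\underline{\omega}_\sigma^{\otimes 2}$.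 **Nearly holomorphic forms.** $W_\kappa$ is the one-dimensional representation of $\mathbb{T}$ of character $\kappa$. $V_\kappa=W_\kappa[\underline{Y}]$, $\underline{Y}=(Y_\sigma)_{\sigma\in I}$, with $Q$ acting by $(g\cdot P)(\underline{Y})=\kappa(a)P(a^{-1}(b+\underline{Y}d))$ for $g=\begin{pmatrix}a&b\\0&d\end{pmatrix}$ (componentwise in $\sigma$), $\mathfrak{q}$ acting by differentiation, and $\mu_\sigma^-$ (the element of $\mathfrak{g}=\prod_\tau\mathfrak{gl}_2$ equal to $\begin{pmatrix}0&0\\1&0\end{pmatrix}$ at $\sigma$, zero elsewhere) acting by $\mu_\sigma^-\cdot P=k_\sigma Y_\sigma P-Y_\sigma^2\frac{\partial P}{\partial Y_\sigma}$. $V_\kappa^\nu$ is the subspace of polynomials of degree at most $r_\sigma$ in each $Y_\sigma$. $\mathcal{V}_\kappa=T^{\times,+}_{\mathcal{H}}\times_QV_\kappa$, $\mathcal{V}_\kappa^\nu=T^{\times,+}_{\mathcal{H}}\times_QV_\kappa^\nu$; sections are functions $f$ of frames $\alpha$ with $f(\alpha g)=g^{-1}\cdot f(\alpha)$, $g\in Q$. The connection on $\mathcal{V}_\kappa$ is $\nabla_{\mathcal{V}_\kappa}(D)(f)(\alpha)=D(f(\alpha))+X(D,\alpha)\cdot f(\alpha)$, where for a local frame $\alpha$ and a vector field $D$, $X(D,\alpha)\in\mathfrak{g}$ is the matrix of $\nabla(D)$ on $\mathcal{H}$ in the basis $\alpha$. $\nabla_\sigma$ is the composite $\mathcal{V}_\kappa\xrightarrow{\nabla_{\mathcal{V}_\kappa}}\mathcal{V}_\kappa\otimes\Omega^1_X(\log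 C)\xrightarrow{1\otimes\mathrm{KS}_\sigma}\mathcal{V}_\kappa\otimes\underline{\omega}_\sigma^{\otimes2}\cong\mathcal{V}_{\kappa+2\sigma}$; it maps $\mathcal{V}_\kappa^\nu$ to $\mathcal{V}_{\kappa+2\sigma}^{\nu+\sigma}$. **The map $\phi$.** $\mathfrak{h}$ is the upper half-plane, $\mathfrak{h}_F=\prod_{\sigma\in I}\mathfrak{h}$. For $\underline{z}=(z_\sigma)_\sigma\in\mathfrak{h}_F$ let $A_{\underline{z}}=(\mathcal{O}_F\otimes\mathbb{C})/L_{\underline{z}}$, with $L_{\underline{z}}\subset\prod_\sigma\mathbb{C}$ the $\mathcal{O}_F$-lattice generated by $(1)_\sigma$ and $(z_\sigma)_\sigma$, with the natural $\mathcal{O}_F$-action $\iota_{\underline{z}}$, level structure $\psi_{\underline{z}}$ from $\frac1N\mathcal{O}_F/\mathcal{O}_F\subset(\mathcal{O}_F\otimes\mathbb{C})/L_{\underline{z}}$, and standard trace-form polarization $\lambda_{\underline{z}}$. Let $\mathrm{d}w=(\mathrm{d}w_\sigma)_\sigma$ be the invariant differential given by the standard coordinates on $\prod_\sigma\mathbb{C}$, and let $\beta=(\beta_\sigma)_\sigma$ with $\beta_\sigma\big((a_\tau+b_\tau z_\tau)_\tau\big)=b_\sigma$ for $a_\tau,b_\tau\in\mathbb{R}$ (a $\nabla$-horizontal class in $H^1_{dR}(A_{\underline{z}})$). Then $(\mathrm{d}w,\beta)$ is a holomorphic filtered frame. Put $s_\sigma=\frac1{z_\sigma-\overline{z}_\sigma}$,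 $s=(s_\sigma)_\sigma$; then $(\mathrm{d}w,-\mathrm{d}\overline{w}\,s)=(\mathrm{d}w,\beta)\begin{pmatrix}1&-s\\0&1\end{pmatrix}$. For a global section $f$ of $\mathcal{V}_\kappa^\nu$, write $f(A_{\underline{z}},\iota_{\underline{z}},\psi_{\underline{z}},\lambda_{\underline{z}},\mathrm{d}w,\beta)=P_f(\underline{Y})$, a polynomial with coefficients holomorphic in $\underline{z}$, and define $\phi(f)(\underline{z})=f(A_{\underline{z}},\iota_{\underline{z}},\psi_{\underline{z}},\lambda_{\underline{z}},\mathrm{d}w,-\mathrm{d}\overline{w}\,s)|_{\underline{Y}=0}=P_f(s(\underline{z}))$. **Maass–Shimura operator.** For a $C^\infty$ function $h$ on $\mathfrak{h}_F$, $D_\kappa^\sigma(h)=\kappa(s)\frac{\partial}{\partial z_\sigma}\left[\kappa(s^{-1})h\right]$. *)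

theory Defs
  imports "HOL-Analysis.Analysis"
begin

section \<open>Totally real fields\<close>

text \<open>
  The field \<open>F\<close> is a type \<open>'f\<close>, and its set \<open>I\<close> of real embeddings is indexed bijectively
  by a finite type \<open>'n\<close>, so that \<open>F \<otimes> \<real>\<close> is \<^typ>\<open>real^'n\<close> and \<open>F \<otimes> \<complex>\<close> is
  \<^typ>\<open>complex^'n\<close>.
\<close>

definition field_embedding :: "('a::field \<Rightarrow> 'b::field) \<Rightarrow> bool" where
  "field_embedding h \<longleftrightarrow>
     h 1 = 1 \<and> (\<forall>x y. h (x + y) = h x + h y) \<and> (\<forall>x y. h (x * y) = h x * h y)"

abbreviation rat_scale :: "rat \<Rightarrow> 'f::field_char_0 \<Rightarrow> 'f" where
  "rat_scale q x \<equiv> of_rat q * x"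

definition totally_real_field :: "('n::finite \<Rightarrow> 'f::field_char_0 \<Rightarrow> real) \<Rightarrow> bool" where
  "totally_real_field emb \<longleftrightarrow>
     (\<exists>B::'f set. finite B \<and> module.span rat_scale B = UNIV) \<and>
     vector_space.dim rat_scale (UNIV :: 'f set) > 1 \<and>
     (\<forall>\<tau>::'f \<Rightarrow> complex. field_embedding \<tau> \<longrightarrow> range \<tau> \<subseteq> \<real>) \<and>
     bij_betw emb UNIV {\<sigma>. field_embedding \<sigma>}"

definition ring_of_integers :: "'f::field_char_0 set" where
  "ring_of_integers = {x. algebraic_int x}"

definition emb_vec :: "('n::finite \<Rightarrow> 'f \<Rightarrow> real) \<Rightarrow> 'f \<Rightarrow> real^'n" where
  "emb_vec emb x = (\<chi> i. emb i x)"

section \<open>Holomorphic functions of several variables\<close>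

definition holo_on :: "(complex^'n::finite \<Rightarrow> complex) \<Rightarrow> (complex^'n) set \<Rightarrow> bool" where
  "holo_on g U \<longleftrightarrow>
     (\<forall>z\<in>U. \<exists>g'. (g has_derivative g') (at z) \<and> (\<forall>c v. g' (c *s v) = c * g' v))"

definition dir_deriv :: "complex^'n::finite \<Rightarrow> (complex^'n \<Rightarrow> complex) \<Rightarrow> complex^'n \<Rightarrow> complex" where
  "dir_deriv D g z = deriv (\<lambda>t. g (z + t *s D)) 0"

text \<open>The Wirtinger derivative of a function that is differentiable in the real sense only.\<close>

definition wirtinger :: "'n::finite \<Rightarrow> (complex^'n \<Rightarrow> complex) \<Rightarrow> complex^'n \<Rightarrow> complex" where
  "wirtinger i h z =
     (vector_derivative (\<lambda>t::real. h (z + axis i (complex_of_real t))) (at 0)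
      - \<i> * vector_derivative (\<lambda>t::real. h (z + axis i (\<i> * complex_of_real t))) (at 0)) / 2"

section \<open>The abelian varieties \<open>A\<^sub>z\<close> and their de Rham cohomology\<close>

definition upper_half :: "(complex^'n::finite) set" where
  "upper_half = {z. \<forall>i. Im (z $ i) > 0}"

text \<open>For \<open>z\<close> in the upper half space every \<open>v\<close> is uniquely \<open>a + b z\<close> with real \<open>a\<close>, \<open>b\<close>.\<close>

definition per :: "complex^'n::finite \<Rightarrow> real^'n \<Rightarrow> real^'n \<Rightarrow> complex^'n" where
  "per z a b = (\<chi> i. of_real (a $ i) + of_real (b $ i) * z $ i)"

definition coord_b :: "complex^'n::finite \<Rightarrow> complex^'n \<Rightarrow> real^'n" where
  "coord_b z v = (\<chi> i. Im (v $ i) / Im (z $ i))"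

definition coord_a :: "complex^'n::finite \<Rightarrow> complex^'n \<Rightarrow> real^'n" where
  "coord_a z v = (\<chi> i. Re (v $ i) - coord_b z v $ i * Re (z $ i))"

definition lattice_of :: "('n::finite \<Rightarrow> 'f::field_char_0 \<Rightarrow> real) \<Rightarrow> complex^'n \<Rightarrow> (complex^'n) set" where
  "lattice_of emb z =
     {per z (emb_vec emb x) (emb_vec emb y) | x y. x \<in> ring_of_integers \<and> y \<in> ring_of_integers}"

definition of_action :: "('n::finite \<Rightarrow> 'f \<Rightarrow> real) \<Rightarrow> 'f \<Rightarrow> complex^'n \<Rightarrow> complex^'n" where
  "of_action emb x v = (\<chi> i. of_real (emb i x) * v $ i)"

definition trace_form :: "complex^'n::finite \<Rightarrow> complex^'n \<Rightarrow> complex^'n \<Rightarrow> real" where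
  "trace_form z v w =
     (\<Sum>i\<in>UNIV. coord_a z v $ i * coord_b z w $ i - coord_a z w $ i * coord_b z v $ i)"

text \<open>
  Isomorphisms of \<open>(A\<^sub>z, \<iota>, \<psi>, \<lambda>)\<close> with \<open>(A\<^sub>z', \<iota>, \<psi>, \<lambda>)\<close>, given by their lifts to the universal
  covers. The complex points of \<open>Y\<close> are the \<open>z\<close> in the upper half space up to isomorphism.
\<close>

definition hbav_iso :: "('n::finite \<Rightarrow> 'f::field_char_0 \<Rightarrow> real) \<Rightarrow> nat \<Rightarrow> complex^'n \<Rightarrow> complex^'n
    \<Rightarrow> (complex^'n \<Rightarrow> complex^'n) \<Rightarrow> bool" where
  "hbav_iso emb N z z' u \<longleftrightarrow>
     (\<forall>v w. u (v + w) = u v + u w) \<and> (\<forall>c v. u (c *s v) = c *s u v) \<and>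
     (\<forall>x\<in>ring_of_integers. \<forall>v. u (of_action emb x v) = of_action emb x (u v)) \<and>
     u ` lattice_of emb z = lattice_of emb z' \<and>
     (\<forall>x\<in>ring_of_integers. u (per z (emb_vec emb (x / of_nat N)) 0)
        - per z' (emb_vec emb (x / of_nat N)) 0 \<in> lattice_of emb z') \<and>
     (\<forall>v w. trace_form z' (u v) (u w) = trace_form z v w)"

text \<open>
  \<open>H\<^sup>1\<^sub>d\<^sub>R(A\<^sub>z)\<close> is the space of \<open>\<real>\<close>-linear functionals \<open>\<complex>\<^sup>I \<rightarrow> \<complex>\<close> (translation invariant complex
  1-forms, equivalently the \<open>\<complex>\<close>-valued functionals on the lattice). \<open>H_comp emb i\<close> is the
  component on which \<open>\<O>\<^sub>F\<close> acts through the embedding \<open>i\<close>, and \<open>omega_comp emb i\<close> the part of it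
  in the Hodge filtration.
\<close>

type_synonym 'n functional = "complex^'n \<Rightarrow> complex"

definition H_comp :: "('n::finite \<Rightarrow> 'f::field_char_0 \<Rightarrow> real) \<Rightarrow> 'n \<Rightarrow> 'n functional set" where
  "H_comp emb i = {\<eta>. linear \<eta> \<and>
     (\<forall>x\<in>ring_of_integers. \<forall>v. \<eta> (of_action emb x v) = of_real (emb i x) * \<eta> v)}"

definition omega_comp :: "('n::finite \<Rightarrow> 'f::field_char_0 \<Rightarrow> real) \<Rightarrow> 'n \<Rightarrow> 'n functional set" where
  "omega_comp emb i = {\<eta> \<in> H_comp emb i. \<forall>c v. \<eta> (c *s v) = c * \<eta> v}"

text \<open>
  An \<open>\<O>\<^sub>F\<close>-linear frame \<open>(\<O>\<^sub>F \<otimes> \<complex>)\<^sup>2 \<cong> H\<^sup>1\<^sub>d\<^sub>R(A\<^sub>z)\<close> taking the first summand onto \<open>\<omega>\<close> is the same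
  as a basis \<open>(\<alpha> i 1, \<alpha> i 2)\<close> of every component with \<open>\<alpha> i 1\<close> a basis of \<open>\<omega>\<close>.
\<close>

type_synonym 'n frame = "'n \<Rightarrow> 2 \<Rightarrow> 'n functional"

definition is_frame :: "('n::finite \<Rightarrow> 'f::field_char_0 \<Rightarrow> real) \<Rightarrow> 'n frame \<Rightarrow> bool" where
  "is_frame emb \<alpha> \<longleftrightarrow> (\<forall>i.
     (\<forall>k. \<alpha> i k \<in> H_comp emb i) \<and> \<alpha> i 1 \<in> omega_comp emb i \<and>
     (\<forall>\<eta>\<in>H_comp emb i. \<exists>!c::complex^2. \<eta> = (\<lambda>v. \<Sum>k\<in>UNIV. c $ k * \<alpha> i k v)) \<and>
     (\<forall>\<eta>\<in>omega_comp emb i. \<exists>!c. \<eta> = (\<lambda>v. c * \<alpha> i 1 v)))"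

text \<open>
  The holomorphic structure of \<open>\<H>\<close> over the upper half space is the one for which sections
  with constant periods along the lattices are holomorphic.
\<close>

definition local_frame :: "('n::finite \<Rightarrow> 'f::field_char_0 \<Rightarrow> real) \<Rightarrow> (complex^'n) set
    \<Rightarrow> (complex^'n \<Rightarrow> 'n frame) \<Rightarrow> bool" where
  "local_frame emb U \<alpha> \<longleftrightarrow> open U \<and> U \<subseteq> upper_half \<and>
     (\<forall>z\<in>U. is_frame emb (\<alpha> z)) \<and>
     (\<forall>i k a b. holo_on (\<lambda>z. \<alpha> z i k (per z a b)) U)"

text \<open>The Gauss--Manin connection differentiates periods: the value at \<open>v = a + b z\<close>
  is the derivative at \<open>z\<close> of \<open>z' \<mapsto> \<eta>\<^sub>z'(a + b z')\<close> along \<open>D\<close>.\<close>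

definition gauss_manin :: "complex^'n::finite \<Rightarrow> (complex^'n \<Rightarrow> 'n functional) \<Rightarrow> complex^'n
    \<Rightarrow> 'n functional" where
  "gauss_manin D \<eta> z = (\<lambda>v. dir_deriv D (\<lambda>z'. \<eta> z' (per z' (coord_a z v) (coord_b z v))) z)"

text \<open>The pairing on \<open>H_comp emb i\<close> dual to the \<open>i\<close>-component of \<^const>\<open>trace_form\<close>, for which
  \<open>axis i 1\<close>, \<open>axis i (z $ i)\<close> is a symplectic basis.\<close>

definition pol_pairing :: "'n::finite \<Rightarrow> complex^'n \<Rightarrow> 'n functional \<Rightarrow> 'n functional \<Rightarrow> complex" where
  "pol_pairing i z \<eta> \<eta>' =
     \<eta> (axis i 1) * \<eta>' (axis i (z $ i)) - \<eta> (axis i (z $ i)) * \<eta>' (axis i 1)"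

text \<open>
  The 1-form corresponding to \<open>\<eta> \<otimes> \<eta>\<close> under the Kodaira--Spencer isomorphism, as a function of
  the tangent vector \<open>D\<close>. To differentiate \<open>\<eta> \<in> \<omega>\<^sub>i\<close> it is extended to the holomorphic section of
  \<open>\<omega>\<^sub>i\<close> which is constant as a functional on \<open>\<complex>\<^sup>I\<close>; another extension changes
  the derivative by an element of \<open>\<omega>\<^sub>i\<close>, which pairs to zero with \<open>\<eta>\<close>.
\<close>

definition ks_inverse :: "'n::finite \<Rightarrow> complex^'n \<Rightarrow> 'n functional \<Rightarrow> complex^'n \<Rightarrow> complex" where
  "ks_inverse i z \<eta> D = pol_pairing i z \<eta> (gauss_manin D (\<lambda>_. \<eta>) z)"

text \<open>The coordinate of \<open>KS\<^sub>i(\<theta>) \<in> \<omega>\<^sub>i\<^sup>\<otimes>\<^sup>2\<close> with respect to \<open>(\<alpha> i 1) \<otimes> (\<alpha> i 1)\<close>.\<close>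

definition ks_coord :: "'n::finite \<Rightarrow> complex^'n \<Rightarrow> 'n frame \<Rightarrow> (complex^'n \<Rightarrow> complex) \<Rightarrow> complex" where
  "ks_coord i z \<alpha> \<theta> = (THE c. \<forall>D. \<theta> D = (\<Sum>j\<in>UNIV. c j * ks_inverse j z (\<alpha> j 1) D)) i"

section \<open>The representations \<open>V\<^sub>\<kappa>\<close>\<close>

text \<open>
  \<open>G(\<complex>)\<close> and its Lie algebra consist of elements of \<^typ>\<open>complex^2^2^'n\<close>; with the one-dimensional
  space \<open>W\<^sub>\<kappa>\<close> identified with \<open>\<complex>\<close>, elements of \<open>V\<^sub>\<kappa>\<close> are polynomial functions on
  \<^typ>\<open>complex^'n\<close>.
\<close>

definition mat2 :: "'a::zero \<Rightarrow> 'a \<Rightarrow> 'a \<Rightarrow> 'a \<Rightarrow> 'a^2^2" where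
  "mat2 a b c d = vector [vector [a, b], vector [c, d]]"

definition borel_group :: "(complex^2^2^'n::finite) set" where
  "borel_group = {g. \<forall>i. g $ i $ 2 $ 1 = 0 \<and> g $ i $ 1 $ 1 \<noteq> 0 \<and> g $ i $ 2 $ 2 \<noteq> 0}"

definition weight_char :: "('n::finite \<Rightarrow> int) \<Rightarrow> complex^'n \<Rightarrow> complex" where
  "weight_char \<kappa> t = (\<Prod>i\<in>UNIV. t $ i powi \<kappa> i)"

definition V_type :: "('n::finite \<Rightarrow> nat) \<Rightarrow> (complex^'n \<Rightarrow> complex) set" where
  "V_type \<nu> = {P. \<exists>c. \<forall>Y. P Y = (\<Sum>m\<in>{m. \<forall>i. m i \<le> \<nu> i}. c m * (\<Prod>i\<in>UNIV. (Y $ i) ^ m i))}"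

definition Q_act :: "('n::finite \<Rightarrow> int) \<Rightarrow> complex^2^2^'n \<Rightarrow> (complex^'n \<Rightarrow> complex)
    \<Rightarrow> complex^'n \<Rightarrow> complex" where
  "Q_act \<kappa> g P Y = weight_char \<kappa> (\<chi> i. g $ i $ 1 $ 1)
     * P (\<chi> i. inverse (g $ i $ 1 $ 1) * (g $ i $ 1 $ 2 + Y $ i * g $ i $ 2 $ 2))"

text \<open>The action of \<open>\<qq>\<close> is the derivative at \<open>t = 0\<close> of the action of \<open>1 + t X\<close>.\<close>

definition q_act :: "('n::finite \<Rightarrow> int) \<Rightarrow> complex^2^2^'n \<Rightarrow> (complex^'n \<Rightarrow> complex)
    \<Rightarrow> complex^'n \<Rightarrow> complex" where
  "q_act \<kappa> X P Y = deriv (\<lambda>t. Q_act \<kappa> (\<chi> i. mat 1 + (\<chi> j k. t * X $ i $ j $ k)) P Y) 0"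

definition mu_minus :: "('n::finite \<Rightarrow> int) \<Rightarrow> 'n \<Rightarrow> (complex^'n \<Rightarrow> complex)
    \<Rightarrow> complex^'n \<Rightarrow> complex" where
  "mu_minus \<kappa> i P Y =
     of_int (\<kappa> i) * Y $ i * P Y - (Y $ i)\<^sup>2 * dir_deriv (axis i 1) P Y"

definition upper_part :: "complex^2^2^'n::finite \<Rightarrow> complex^2^2^'n" where
  "upper_part X = (\<chi> i. mat2 (X $ i $ 1 $ 1) (X $ i $ 1 $ 2) 0 (X $ i $ 2 $ 2))"

definition g_act :: "('n::finite \<Rightarrow> int) \<Rightarrow> complex^2^2^'n \<Rightarrow> (complex^'n \<Rightarrow> complex)
    \<Rightarrow> complex^'n \<Rightarrow> complex" where
  "g_act \<kappa> X P Y = q_act \<kappa> (upper_part X) P Y + (\<Sum>i\<in>UNIV. X $ i $ 2 $ 1 * mu_minus \<kappa> i P Y)"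

definition frame_mult :: "'n::finite frame \<Rightarrow> complex^2^2^'n \<Rightarrow> 'n frame" where
  "frame_mult \<alpha> g = (\<lambda>i k v. \<Sum>l\<in>UNIV. \<alpha> i l v * g $ i $ l $ k)"

section \<open>Toroidal compactifications\<close>

definition SL2 :: "('f::field^2^2) set" where
  "SL2 = {\<gamma>. det \<gamma> = 1}"

definition Gamma1 :: "nat \<Rightarrow> ('f::field_char_0^2^2) set" where
  "Gamma1 N = {\<gamma> \<in> SL2. (\<forall>i j. \<gamma> $ i $ j \<in> ring_of_integers) \<and>
     (\<exists>x\<in>ring_of_integers. \<gamma> $ 2 $ 1 = of_nat N * x) \<and>
     (\<exists>x\<in>ring_of_integers. \<gamma> $ 1 $ 1 - 1 = of_nat N * x) \<and>
     (\<exists>x\<in>ring_of_integers. \<gamma> $ 2 $ 2 - 1 = of_nat N * x)}"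

definition autom :: "('n::finite \<Rightarrow> 'f \<Rightarrow> real) \<Rightarrow> 'f^2^2 \<Rightarrow> complex^'n \<Rightarrow> complex^'n" where
  "autom emb \<gamma> z = (\<chi> i. of_real (emb i (\<gamma> $ 2 $ 1)) * z $ i + of_real (emb i (\<gamma> $ 2 $ 2)))"

definition moebius :: "('n::finite \<Rightarrow> 'f \<Rightarrow> real) \<Rightarrow> 'f^2^2 \<Rightarrow> complex^'n \<Rightarrow> complex^'n" where
  "moebius emb \<gamma> z =
     (\<chi> i. (of_real (emb i (\<gamma> $ 1 $ 1)) * z $ i + of_real (emb i (\<gamma> $ 1 $ 2))) / autom emb \<gamma> z $ i)"

text \<open>
  The cusps are the classes of \<open>\<gamma> \<infinity>\<close> for \<open>\<gamma> \<in> SL\<^sub>2(F)\<close>. The stabilizer of \<open>\<infinity>\<close> in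
  \<open>\<gamma>\<^sup>-\<^sup>1 \<Gamma> \<gamma>\<close> acts by translations from \<open>cusp_lattice N \<gamma>\<close> and by squares of \<open>cusp_units N \<gamma>\<close>.
\<close>

definition cusp_lattice :: "nat \<Rightarrow> 'f::field_char_0^2^2 \<Rightarrow> 'f set" where
  "cusp_lattice N \<gamma> = {b. \<exists>\<delta>\<in>Gamma1 N. \<delta> ** \<gamma> = \<gamma> ** mat2 1 b 0 1}"

definition cusp_units :: "nat \<Rightarrow> 'f::field_char_0^2^2 \<Rightarrow> 'f set" where
  "cusp_units N \<gamma> = {e. e \<noteq> 0 \<and> (\<exists>b. \<exists>\<delta>\<in>Gamma1 N. \<delta> ** \<gamma> = \<gamma> ** mat2 e b 0 (inverse e))}"

definition int_basis :: "('n::finite \<Rightarrow> 'f::field_char_0) \<Rightarrow> 'f set \<Rightarrow> bool" where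
  "int_basis m M \<longleftrightarrow> bij_betw (\<lambda>c::'n \<Rightarrow> int. \<Sum>j\<in>UNIV. of_int (c j) * m j) UNIV M"

definition cone_of :: "('n::finite \<Rightarrow> 'f \<Rightarrow> real) \<Rightarrow> 'f set \<Rightarrow> (real^'n) set" where
  "cone_of emb J = convex_cone hull (emb_vec emb ` J)"

definition pos_cone :: "(real^'n::finite) set" where
  "pos_cone = insert 0 {x. \<forall>i. 0 < x $ i}"

text \<open>
  A smooth projective toroidal compactification \<open>X\<close> is given by a fan at every cusp \<open>\<gamma> \<infinity>\<close>,
  compatible with \<open>\<Gamma>\<close> and with the choice of \<open>\<gamma>\<close>. A cone is represented by the set of its
  primitive generators, which by smoothness is part of a basis of the lattice at that cusp.
\<close>

definition smooth_fan :: "('n::finite \<Rightarrow> 'f::field_char_0 \<Rightarrow> real) \<Rightarrow> nat \<Rightarrow> 'f^2^2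
    \<Rightarrow> 'f set set \<Rightarrow> bool" where
  "smooth_fan emb N \<gamma> S \<longleftrightarrow>
     (\<forall>J\<in>S. \<exists>m::'n \<Rightarrow> 'f. int_basis m (cusp_lattice N \<gamma>) \<and> J \<subseteq> range m) \<and>
     (\<forall>J\<in>S. \<forall>K. K \<subseteq> J \<longrightarrow> K \<in> S) \<and>
     (\<forall>J\<in>S. \<forall>K\<in>S. cone_of emb J \<inter> cone_of emb K = cone_of emb (J \<inter> K)) \<and>
     (\<Union>J\<in>S. cone_of emb J) = pos_cone \<and>
     (\<exists>T. finite T \<and> T \<subseteq> S \<and> (\<forall>J\<in>S. \<exists>K\<in>T. \<exists>e\<in>cusp_units N \<gamma>. J = (\<lambda>x. e\<^sup>2 * x) ` K))"

text \<open>Projectivity is the existence of an invariant integral polarization function: piecewise linear,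
  concave, and with the top-dimensional cones as its domains of linearity.\<close>

definition polarization_function :: "('n::finite \<Rightarrow> 'f::field_char_0 \<Rightarrow> real) \<Rightarrow> nat \<Rightarrow> 'f^2^2
    \<Rightarrow> 'f set set \<Rightarrow> (real^'n \<Rightarrow> real) \<Rightarrow> bool" where
  "polarization_function emb N \<gamma> S h \<longleftrightarrow>
     (\<forall>x\<in>pos_cone. x \<noteq> 0 \<longrightarrow> h x > 0) \<and>
     (\<forall>x\<in>cusp_lattice N \<gamma>. emb_vec emb x \<in> pos_cone \<longrightarrow> h (emb_vec emb x) \<in> \<int>) \<and>
     (\<forall>J\<in>S. card J = CARD('n) \<longrightarrow> (\<exists>l. linear l \<and>
        (\<forall>x\<in>pos_cone. h x \<le> l x \<and> (h x = l x \<longleftrightarrow> x \<in> cone_of emb J))))"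

definition projective_toroidal_data :: "('n::finite \<Rightarrow> 'f::field_char_0 \<Rightarrow> real) \<Rightarrow> nat
    \<Rightarrow> ('f^2^2 \<Rightarrow> 'f set set) \<Rightarrow> bool" where
  "projective_toroidal_data emb N fan \<longleftrightarrow>
     (\<forall>\<gamma>\<in>SL2. smooth_fan emb N \<gamma> (fan \<gamma>)) \<and>
     (\<forall>\<gamma>\<in>SL2. \<forall>\<delta>\<in>Gamma1 N. \<forall>e b. e \<noteq> 0 \<longrightarrow>
        fan \<gamma> = (\<lambda>J. (\<lambda>x. e\<^sup>2 * x) ` J) ` fan (\<delta> ** \<gamma> ** mat2 e b 0 (inverse e))) \<and>
     (\<exists>h. (\<forall>\<gamma>\<in>SL2. polarization_function emb N \<gamma> (fan \<gamma>) (h \<gamma>)) \<and>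
        (\<forall>\<gamma>\<in>SL2. \<forall>\<delta>\<in>Gamma1 N. \<forall>e b. e \<noteq> 0 \<longrightarrow> (\<forall>x\<in>pos_cone.
           h (\<delta> ** \<gamma> ** mat2 e b 0 (inverse e)) x = h \<gamma> (\<chi> i. (emb i e)\<^sup>2 * x $ i))))"

definition torus_point :: "('n::finite \<Rightarrow> 'f \<Rightarrow> real) \<Rightarrow> ('n \<Rightarrow> 'f) \<Rightarrow> complex^'n \<Rightarrow> complex^'n" where
  "torus_point emb m u = (\<chi> i. \<Sum>j\<in>UNIV. u $ j * of_real (emb i (m j)))"

definition torus_coord :: "complex^'n::finite \<Rightarrow> complex^'n" where
  "torus_coord u = (\<chi> j. exp (2 * of_real pi * \<i> * u $ j))"

section \<open>The frames used for sections and for \<open>\<phi>\<close>\<close>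

definition s_fun :: "complex^'n::finite \<Rightarrow> complex^'n" where
  "s_fun z = (\<chi> i. 1 / (z $ i - cnj (z $ i)))"

definition std_frame :: "complex^'n::finite \<Rightarrow> 'n frame" where
  "std_frame z = (\<lambda>i k v. if k = 1 then v $ i else of_real (coord_b z v $ i))"

definition ms_frame :: "complex^'n::finite \<Rightarrow> 'n frame" where
  "ms_frame z = (\<lambda>i k v. if k = 1 then v $ i else - cnj (v $ i) * s_fun z $ i)"

text \<open>
  The frame of \<open>\<H>\<close> at \<open>\<gamma> z\<close> obtained from \<open>(dw, \<beta>)\<close> at \<open>z\<close> through the isogeny
  \<open>v \<mapsto> (c z + d) v\<close> from \<open>A\<^bsub>\<gamma> z\<^esub>\<close> to \<open>A\<^sub>z\<close>. It is invariant under the translations at the cusp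
  \<open>\<gamma> \<infinity>\<close>, and \<open>\<nabla>(dw) = \<beta> dz\<close>, \<open>\<nabla>(\<beta>) = 0\<close> show that it generates the canonical extension of
  \<open>\<H>\<close> (and its first half the extension of \<open>\<omega>\<close>) near the boundary at that cusp.
\<close>

definition cusp_frame :: "('n::finite \<Rightarrow> 'f \<Rightarrow> real) \<Rightarrow> 'f^2^2 \<Rightarrow> complex^'n \<Rightarrow> 'n frame" where
  "cusp_frame emb \<gamma> z = (\<lambda>i k v. std_frame z i k (\<chi> j. autom emb \<gamma> z $ j * v $ j))"

section \<open>Nearly holomorphic forms\<close>

text \<open>
  A section of \<open>\<V>\<^sub>\<kappa>\<close> over the complex points of \<open>Y\<close> is a function \<open>f z \<alpha>\<close> of \<open>z\<close> and a frame of
  \<open>H\<^sup>1\<^sub>d\<^sub>R(A\<^sub>z)\<close>, depending only on the isomorphism class of the data.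
\<close>

type_synonym 'n nh_section = "complex^'n \<Rightarrow> 'n frame \<Rightarrow> complex^'n \<Rightarrow> complex"

definition section_on_Y :: "('n::finite \<Rightarrow> 'f::field_char_0 \<Rightarrow> real) \<Rightarrow> nat \<Rightarrow> ('n \<Rightarrow> int)
    \<Rightarrow> ('n \<Rightarrow> nat) \<Rightarrow> 'n nh_section \<Rightarrow> bool" where
  "section_on_Y emb N \<kappa> \<nu> f \<longleftrightarrow>
     (\<forall>z\<in>upper_half. \<forall>\<alpha>. is_frame emb \<alpha> \<longrightarrow> f z \<alpha> \<in> V_type \<nu>) \<and>
     (\<forall>z\<in>upper_half. \<forall>\<alpha>. \<forall>g\<in>borel_group. is_frame emb \<alpha> \<longrightarrow>
        f z (frame_mult \<alpha> g) = Q_act \<kappa> (\<chi> i. matrix_inv (g $ i)) (f z \<alpha>)) \<and>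
     (\<forall>U \<alpha>. local_frame emb U \<alpha> \<longrightarrow> (\<forall>Y. holo_on (\<lambda>z. f z (\<alpha> z) Y) U)) \<and>
     (\<forall>z\<in>upper_half. \<forall>z'\<in>upper_half. \<forall>u \<alpha>. hbav_iso emb N z z' u \<longrightarrow> is_frame emb \<alpha> \<longrightarrow>
        f z (\<lambda>i k v. \<alpha> i k (u v)) = f z' \<alpha>)"

text \<open>
  Near the stratum of the cone generated by \<open>J\<close>, with \<open>m\<close> a basis of the lattice containing \<open>J\<close>,
  the coordinates of \<open>X\<close> are \<open>q\<^sub>j = exp (2 \<pi> i u\<^sub>j)\<close>, where \<open>z = \<Sum>\<^sub>j u\<^sub>j m\<^sub>j\<close>, and the points \<open>q0\<close> of the
  stratum are those where exactly the \<open>q\<^sub>j\<close> with \<open>m j \<in> J\<close> vanish. As \<open>Y\<close> is dense in \<open>X\<close>, a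
  global section over \<open>X\<close> is a section over \<open>Y\<close> that extends; this is the case if its
  polynomial in the frame \<^const>\<open>cusp_frame\<close> of the canonical extension extends holomorphically to
  neighbourhoods of all \<open>q0\<close>.
\<close>

definition extends_to_boundary :: "('n::finite \<Rightarrow> 'f::field_char_0 \<Rightarrow> real) \<Rightarrow> nat
    \<Rightarrow> ('f^2^2 \<Rightarrow> 'f set set) \<Rightarrow> 'n nh_section \<Rightarrow> bool" where
  "extends_to_boundary emb N fan f \<longleftrightarrow>
     (\<forall>\<gamma>\<in>SL2. \<forall>J\<in>fan \<gamma>. \<forall>m. J \<noteq> {} \<longrightarrow> int_basis m (cusp_lattice N \<gamma>) \<longrightarrow> J \<subseteq> range m \<longrightarrow>
       (\<forall>Y q0. (\<forall>j. q0 $ j = 0 \<longleftrightarrow> m j \<in> J) \<longrightarrow>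
         (\<exists>W g. open W \<and> q0 \<in> W \<and> holo_on g W \<and>
           (\<forall>u. torus_coord u \<in> W \<longrightarrow> torus_point emb m u \<in> upper_half \<longrightarrow>
              f (moebius emb \<gamma> (torus_point emb m u)) (cusp_frame emb \<gamma> (torus_point emb m u)) Y
                = g (torus_coord u)))))"

definition global_sections :: "('n::finite \<Rightarrow> 'f::field_char_0 \<Rightarrow> real) \<Rightarrow> nat
    \<Rightarrow> ('f^2^2 \<Rightarrow> 'f set set) \<Rightarrow> ('n \<Rightarrow> int) \<Rightarrow> ('n \<Rightarrow> nat) \<Rightarrow> 'n nh_section set" where
  "global_sections emb N fan \<kappa> \<nu> =
     {f. section_on_Y emb N \<kappa> \<nu> f \<and> extends_to_boundary emb N fan f}"

section \<open>The operators\<close>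

definition conn_matrix :: "complex^'n::finite \<Rightarrow> (complex^'n \<Rightarrow> 'n frame) \<Rightarrow> complex^'n
    \<Rightarrow> complex^2^2^'n" where
  "conn_matrix D \<alpha> z = (THE X. \<forall>i k.
     gauss_manin D (\<lambda>z'. \<alpha> z' i k) z = (\<lambda>v. \<Sum>l\<in>UNIV. \<alpha> z i l v * X $ i $ l $ k))"

text \<open>The value at the frame \<open>\<alpha>0\<close> of \<open>A\<^sub>z\<close> is computed from any holomorphic local frame
  through \<open>\<alpha>0\<close>.\<close>

definition nabla_V :: "('n::finite \<Rightarrow> 'f::field_char_0 \<Rightarrow> real) \<Rightarrow> ('n \<Rightarrow> int) \<Rightarrow> complex^'n
    \<Rightarrow> 'n nh_section \<Rightarrow> 'n nh_section" where
  "nabla_V emb \<kappa> D f z \<alpha>0 = (THE P. \<forall>U \<alpha>. local_frame emb U \<alpha> \<and> z \<in> U \<and> \<alpha> z = \<alpha>0 \<longrightarrow>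
     P = (\<lambda>Y. dir_deriv D (\<lambda>z'. f z' (\<alpha> z') Y) z + g_act \<kappa> (conn_matrix D \<alpha> z) (f z (\<alpha> z)) Y))"

text \<open>A section of \<open>\<V>\<^sub>\<kappa> \<otimes> \<omega>\<^sub>i\<^sup>\<otimes>\<^sup>2\<close> becomes a section of \<open>\<V>\<close> of weight \<open>\<kappa> + 2 i\<close> by taking its
  coordinate with respect to \<open>(\<alpha> i 1) \<otimes> (\<alpha> i 1)\<close> at the frame \<open>\<alpha>\<close>.\<close>

definition nabla_comp :: "('n::finite \<Rightarrow> 'f::field_char_0 \<Rightarrow> real) \<Rightarrow> ('n \<Rightarrow> int) \<Rightarrow> 'n
    \<Rightarrow> 'n nh_section \<Rightarrow> 'n nh_section" where
  "nabla_comp emb \<kappa> i f z \<alpha> = (\<lambda>Y. ks_coord i z \<alpha> (\<lambda>D. nabla_V emb \<kappa> D f z \<alpha> Y))"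

definition phi_map :: "'n::finite nh_section \<Rightarrow> complex^'n \<Rightarrow> complex" where
  "phi_map f z = f z (ms_frame z) 0"

definition maass_shimura :: "('n::finite \<Rightarrow> int) \<Rightarrow> 'n \<Rightarrow> (complex^'n \<Rightarrow> complex)
    \<Rightarrow> complex^'n \<Rightarrow> complex" where
  "maass_shimura \<kappa> i h z = weight_char \<kappa> (s_fun z) *
     wirtinger i (\<lambda>z'. weight_char \<kappa> (\<chi> j. inverse (s_fun z' $ j)) * h z') z"

end

theory Submission
  imports Defs
begin

text \<open>
  Over the upper half space a section \<open>f\<close> is the family of polynomials \<open>P\<^sub>z = f z (dw, \<beta>)\<close>. Its
  coefficients are holomorphic in \<open>z\<close>, and all other values of \<open>f\<close> follow from equivariance under the
  Borel group. Both sides of the theorem are computed from \<open>P\<close>.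

  In the frame \<open>(dw, \<beta>)\<close> the Gauss--Manin connection is \<open>\<nabla>(dw\<^sub>i) = \<beta>\<^sub>i dz\<^sub>i\<close> and \<open>\<nabla>(\<beta>\<^sub>i) = 0\<close>: along a
  vector \<open>D\<close> its matrix is \<open>\<Sum>\<^sub>i D\<^sub>i \<mu>\<^sub>i\<^sup>-\<close>. As Kodaira--Spencer sends \<open>dz\<^sub>i\<close> to \<open>dw\<^sub>i\<^sup>\<otimes>\<^sup>2\<close>, the polynomial of
  \<open>\<nabla>\<^sub>\<sigma> f\<close> in that frame is \<open>\<partial>P/\<partial>z\<^sub>\<sigma> + \<mu>\<^sub>\<sigma>\<^sup>- P = \<partial>P/\<partial>z\<^sub>\<sigma> + k\<^sub>\<sigma> Y\<^sub>\<sigma> P - Y\<^sub>\<sigma>\<^sup>2 \<partial>P/\<partial>Y\<^sub>\<sigma>\<close>, and \<open>\<phi>\<close> evaluates it at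
  \<open>Y = s(z)\<close> (\<open>phi_nabla_comp\<close>). On the other side \<open>\<phi>(f) = P\<^sub>z(s(z))\<close>, and \<open>\<partial>s\<^sub>\<sigma>/\<partial>z\<^sub>\<sigma> = - s\<^sub>\<sigma>\<^sup>2\<close>; the chain
  rule produces \<open>- s\<^sub>\<sigma>\<^sup>2 \<partial>P/\<partial>Y\<^sub>\<sigma>\<close>, and differentiating the factor \<open>\<kappa>(s\<^sup>-\<^sup>1)\<close> produces \<open>k\<^sub>\<sigma> s\<^sub>\<sigma> P\<close>
  (\<open>maass_shimura_phi\<close>).

  Three points need an argument beyond this computation. First, every frame must be a Borel multiple
  of \<open>(dw, \<beta>)\<close>. This requires each component of de Rham cohomology to be a plane, which holds because
  algebraic integers separate the real embeddings (\<open>H_comp_expand\<close>, \<open>frame_eq_std_frame_mult\<close>).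
  Secondly, \<open>P\<^sub>z(Y)\<close> is only known to be holomorphic in \<open>z\<close> for each \<open>Y\<close> and polynomial in \<open>Y\<close> for each
  \<open>z\<close>; interpolation at integer points makes it differentiable in both together
  (\<open>V_type_family_chain\<close>). Thirdly, the frame \<open>(dw, - dw\<^sup>c s)\<close>, where \<open>dw\<^sup>c\<close> is the complex conjugate
  of \<open>dw\<close>, is not holomorphic in \<open>z\<close>, so that the
  connection at its value in a point is computed from holomorphic frames through that value. The result
  is independent of their choice, because the derivative of the change of frame enters once through
  the section and once, with opposite sign, through the connection matrix (\<open>nabla_V_at_shear\<close>).
\<close>

section \<open>Algebraic integers separate the real embeddings\<close>

text \<open>
  Among the powers \<open>x\<^sup>0, \<dots>, x\<^sup>n\<close>, with \<open>n\<close> the number of generators, either two coincide or there is a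
  linear dependence over the rationals; each case is a polynomial relation for \<open>x\<close>.
\<close>

lemma finite_dimensional_imp_algebraic:
  fixes x :: "'f::field_char_0"
  assumes "finite (B :: 'f set)" and "module.span rat_scale B = UNIV"
  shows "algebraic x"
proof -
  interpret V: vector_space "rat_scale :: rat \<Rightarrow> 'f \<Rightarrow> 'f"
    by unfold_locales (simp_all add: algebra_simps of_rat_add of_rat_mult)
  define n where "n = card B"
  show ?thesis
  proof (cases "inj_on (\<lambda>i. x ^ i) {..n}")
    case False
    then obtain i j where ij: "x ^ i = x ^ j" "i \<noteq> j"
      by (auto simp: inj_on_def)
    have "coeff (monom 1 i - monom (1::'f) j) i \<noteq> 0"
      using ij by simp
    then have "monom 1 i - monom (1::'f) j \<noteq> 0"
      by (metis coeff_0)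
    moreover have "coeff (monom 1 i - monom (1::'f) j) k \<in> \<int>" for k
      by simp
    ultimately show ?thesis
      using ij by (intro algebraicI[of "monom 1 i - monom 1 j"]) (auto simp: poly_monom)
  next
    case True
    let ?S = "(\<lambda>i. x ^ i) ` {..n}"
    have "card ?S = Suc n"
      using True by (simp add: card_image)
    then have "V.dependent ?S"
      using V.independent_span_bound[OF assms(1), of ?S] assms(2) by (auto simp: n_def)
    then obtain u where u: "\<exists>v\<in>?S. u v \<noteq> 0" "(\<Sum>v\<in>?S. of_rat (u v) * v) = 0"
      by (subst (asm) V.dependent_finite) auto
    define p where "p = (\<Sum>i\<le>n. monom (of_rat (u (x ^ i)) :: 'f) i)"
    have p_coeff: "coeff p i = (if i \<le> n then of_rat (u (x ^ i)) else 0)" for i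
      by (simp add: p_def coeff_sum)
    obtain i where "i \<le> n" "u (x ^ i) \<noteq> 0"
      using u(1) by auto
    then have "coeff p i \<noteq> 0"
      by (simp add: p_coeff)
    then have "p \<noteq> 0"
      by (metis coeff_0)
    moreover have "coeff p i \<in> \<rat>" for i
      by (simp add: p_coeff)
    moreover have "poly p x = 0"
      using u(2) by (simp add: p_def poly_sum poly_monom sum.reindex[OF True])
    ultimately show ?thesis
      by (intro algebraicI') auto
  qed
qed

text \<open>
  The multiplier is the leading coefficient \<open>a\<close> of an integral relation \<open>p\<close> for \<open>x\<close> of degree \<open>n\<close>:
  the product \<open>a\<^sup>n\<^sup>-\<^sup>1 p(x)\<close> is a monic polynomial in \<open>a x\<close>, and its coefficients
  \<open>p\<^sub>i a\<^sup>n\<^sup>-\<^sup>1\<^sup>-\<^sup>i\<close> are still integers.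
\<close>

lemma algebraic_imp_multiple_algebraic_int:
  fixes x :: "'f::field_char_0"
  assumes "algebraic x"
  obtains a :: int where "a \<noteq> 0" and "algebraic_int (of_int a * x)"
proof -
  obtain p where p: "\<And>i. coeff p i \<in> \<int>" "p \<noteq> 0" "poly p x = 0"
    using algebraicE[OF assms] by blast
  define n where "n = degree p"
  obtain a where a: "lead_coeff p = of_int a"
    using p(1) by (auto elim: Ints_cases)
  have "a \<noteq> 0"
    using a p(2) by auto
  have "n > 0"
    using p(2,3) by (auto simp: n_def elim!: degree_eq_zeroE intro!: Nat.gr0I)
  define q where
    "q = monom 1 n + (\<Sum>i<n. monom (coeff p i * of_int a ^ (n - 1 - i)) i)"
  have q_coeff: "coeff q i = (if i = n then 1 else if i < n then coeff p i * of_int a ^ (n - 1 - i) else 0)"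
    for i by (auto simp: q_def coeff_sum)
  have "degree q = n"
    by (intro antisym degree_le le_degree) (auto simp: q_coeff)
  moreover have "coeff q i \<in> \<int>" for i
    by (auto simp: q_coeff p(1))
  moreover have "poly q (of_int a * x) = of_int a ^ (n - 1) * poly p x"
  proof -
    have "poly p x = (\<Sum>i<n. coeff p i * x ^ i) + of_int a * x ^ n"
      using a by (simp add: poly_altdef n_def flip: lessThan_Suc_atMost)
    moreover have "(\<Sum>i<n. coeff p i * of_int a ^ (n - 1 - i) * (of_int a * x) ^ i)
        = (\<Sum>i<n. of_int a ^ (n - 1) * (coeff p i * x ^ i))"
    proof (intro sum.cong refl)
      fix i assume "i \<in> {..<n}"
      then have "of_int a ^ (n - 1) = (of_int a ^ (n - 1 - i) * of_int a ^ i :: 'f)"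
        by (simp flip: power_add)
      then show "coeff p i * of_int a ^ (n - 1 - i) * (of_int a * x) ^ i
          = of_int a ^ (n - 1) * (coeff p i * x ^ i)"
        by (simp add: power_mult_distrib)
    qed
    moreover have "(of_int a * x) ^ n = of_int a ^ (n - 1) * (of_int a * x ^ n)"
      using \<open>n > 0\<close> power_minus_mult[of n "of_int a :: 'f"]
      by (simp add: power_mult_distrib flip: mult.assoc)
    ultimately show ?thesis
      by (simp add: q_def poly_sum poly_monom sum_distrib_left distrib_left add.commute)
  qed
  ultimately have "algebraic_int (of_int a * x)"
    using p(3) by (intro algebraic_int.intros[of q]) (auto simp: q_coeff)
  then show ?thesis
    using that \<open>a \<noteq> 0\<close> by blast
qed

lemma field_embedding_of_int_mult:
  assumes "field_embedding h"
  shows "h (of_int a * x) = of_int a * h x"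
proof -
  have add: "h (y + z) = h y + h z" and mult: "h (y * z) = h y * h z" and one: "h 1 = 1" for y z
    using assms by (auto simp: field_embedding_def)
  have zero: "h 0 = 0"
    using add[of 0 0] by (metis add_0_right add_cancel_left_right)
  have minus: "h (- y) = - h y" for y
    using add[of y "- y"] zero by (simp add: eq_neg_iff_add_eq_0 add.commute)
  have "h (of_nat n) = of_nat n" for n
    by (induction n) (simp_all add: zero one add)
  then have "h (of_int a) = of_int a"
    by (cases a rule: int_cases2) (simp_all add: minus)
  then show ?thesis
    by (simp add: mult)
qed

text \<open>
  Distinct embeddings differ at an element of the field, which becomes integral after multiplication by
  a nonzero integer; embeddings commute with such a multiplication.
\<close>

lemma ring_of_integers_separates_embeddings:
  fixes emb :: "'n::finite \<Rightarrow> 'f::field_char_0 \<Rightarrow> real"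
  assumes "totally_real_field emb" and "i \<noteq> j"
  obtains x where "x \<in> ring_of_integers" and "emb i x \<noteq> emb j x"
proof -
  obtain B :: "'f set" where B: "finite B" "module.span rat_scale B = UNIV"
    and bij: "bij_betw emb UNIV {\<sigma>. field_embedding \<sigma>}"
    using assms(1) by (auto simp: totally_real_field_def)
  have "emb i \<noteq> emb j"
    using bij assms(2) by (auto simp: bij_betw_def inj_on_def)
  then obtain y where y: "emb i y \<noteq> emb j y"
    by blast
  obtain a where a: "a \<noteq> 0" "algebraic_int (of_int a * y)"
    using algebraic_imp_multiple_algebraic_int[OF finite_dimensional_imp_algebraic[OF B]] .
  have "field_embedding (emb k)" for k
    using bij by (auto simp: bij_betw_def)
  then have "emb i (of_int a * y) \<noteq> emb j (of_int a * y)"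
    using y a(1) by (simp add: field_embedding_of_int_mult)
  with a(2) that show ?thesis
    by (auto simp: ring_of_integers_def)
qed

section \<open>The components of de Rham cohomology\<close>

text \<open>
  An integer \<open>x\<close> acts on the \<open>j\<close>-th axis by its \<open>j\<close>-th conjugate, but \<open>\<eta>\<close> transforms by the
  \<open>i\<close>-th. For \<open>x\<close> with different conjugates the two agree only if the value is zero.
\<close>

lemma H_comp_vanishes_on_axis:
  assumes "totally_real_field emb" and "\<eta> \<in> H_comp emb i" and "i \<noteq> j"
  shows "\<eta> (axis j c) = 0"
proof -
  obtain x where x: "x \<in> ring_of_integers" "emb i x \<noteq> emb j x"
    using ring_of_integers_separates_embeddings[OF assms(1,3)] .
  have lin: "linear \<eta>" and act: "\<eta> (of_action emb x v) = of_real (emb i x) * \<eta> v" for v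
    using assms(2) x(1) by (auto simp: H_comp_def)
  have "of_action emb x (axis j c) = emb j x *\<^sub>R axis j c"
    by (auto simp: of_action_def vec_eq_iff axis_def scaleR_conv_of_real[where 'a=complex])
  then have "of_real (emb j x) * \<eta> (axis j c) = of_real (emb i x) * \<eta> (axis j c)"
    using act[of "axis j c"] linear_scale[OF lin] by (simp add: scaleR_conv_of_real[where 'a=complex])
  then show ?thesis
    using x(2) by simp
qed

lemma H_comp_eq_axis:
  assumes "totally_real_field emb" and "\<eta> \<in> H_comp emb i"
  shows "\<eta> v = \<eta> (axis i (v $ i))"
proof -
  have lin: "linear \<eta>"
    using assms(2) by (simp add: H_comp_def)
  have "v = (\<Sum>j\<in>UNIV. axis j (v $ j))"
    by (simp add: vec_eq_iff axis_def)
  then have "\<eta> v = (\<Sum>j\<in>UNIV. \<eta> (axis j (v $ j)))"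
    by (metis linear_sum[OF lin])
  also have "\<dots> = (\<Sum>j\<in>UNIV. if j = i then \<eta> (axis i (v $ i)) else 0)"
    by (intro sum.cong) (use H_comp_vanishes_on_axis[OF assms] in auto)
  finally show ?thesis
    by simp
qed

lemma std_frame_in_H_comp: "std_frame z i k \<in> H_comp emb i"
  unfolding H_comp_def
  by (auto simp: std_frame_def coord_b_def of_action_def scaleR_conv_of_real[where 'a=complex] add_divide_distrib
      algebra_simps intro!: linearI)

lemma std_frame_1_in_omega_comp: "std_frame z i 1 \<in> omega_comp emb i"
  using std_frame_in_H_comp[of z i 1 emb] by (simp add: omega_comp_def std_frame_def)

lemma upper_half_Im_nonzero: "z \<in> upper_half \<Longrightarrow> Im (z $ i) \<noteq> 0"
  by (metis mem_Collect_eq upper_half_def less_irrefl)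

lemma std_frame_axis:
  assumes "z \<in> upper_half"
  shows "std_frame z i 1 (axis i 1) = 1" "std_frame z i 1 (axis i (z $ i)) = z $ i"
    "std_frame z i 2 (axis i 1) = 0" "std_frame z i 2 (axis i (z $ i)) = 1"
  using upper_half_Im_nonzero[OF assms, of i] by (simp_all add: std_frame_def coord_b_def axis_def)

text \<open>
  Every component of de Rham cohomology is a plane with basis \<open>dw\<^sub>i\<close>, \<open>\<beta>\<^sub>i\<close>. A functional in it lives on
  the \<open>i\<close>-th axis, which is spanned over the reals by the periods \<open>1\<close> and \<open>z\<^sub>i\<close>, and the coefficients are
  the values at these periods corrected by the period \<open>z\<^sub>i\<close> of \<open>dw\<^sub>i\<close>.
\<close>

lemma H_comp_expand:
  assumes "totally_real_field emb" and "\<eta> \<in> H_comp emb i" and "z \<in> upper_half"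
  shows "\<eta> = (\<lambda>v. std_frame z i 1 v * \<eta> (axis i 1)
           + std_frame z i 2 v * (\<eta> (axis i (z $ i)) - z $ i * \<eta> (axis i 1)))"
proof
  fix v
  have lin: "linear \<eta>"
    using assms(2) by (simp add: H_comp_def)
  have nz: "Im (z $ i) \<noteq> 0"
    using assms(3) by (rule upper_half_Im_nonzero)
  have "axis i (v $ i) = coord_a z v $ i *\<^sub>R axis i 1 + coord_b z v $ i *\<^sub>R axis i (z $ i)"
    using nz by (auto simp: vec_eq_iff axis_def coord_a_def coord_b_def complex_eq_iff)
  then have "\<eta> v = of_real (coord_a z v $ i) * \<eta> (axis i 1)
               + of_real (coord_b z v $ i) * \<eta> (axis i (z $ i))"
    by (subst H_comp_eq_axis[OF assms(1,2)]) (simp add: linear_add[OF lin] linear_scale[OF lin] scaleR_conv_of_real[where 'a=complex])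
  moreover have "v $ i = of_real (coord_a z v $ i) + of_real (coord_b z v $ i) * z $ i"
    using nz by (simp add: coord_a_def coord_b_def complex_eq_iff)
  ultimately show "\<eta> v = std_frame z i 1 v * \<eta> (axis i 1)
           + std_frame z i 2 v * (\<eta> (axis i (z $ i)) - z $ i * \<eta> (axis i 1))"
    by (simp add: std_frame_def algebra_simps)
qed

lemma coords_per:
  assumes "z \<in> upper_half"
  shows "coord_a z (per z a b) = a" and "coord_b z (per z a b) = b"
  using upper_half_Im_nonzero[OF assms]
  by (simp_all add: vec_eq_iff coord_a_def coord_b_def per_def)

lemma per_coords:
  assumes "z \<in> upper_half"
  shows "per z (coord_a z v) (coord_b z v) = v"
  using upper_half_Im_nonzero[OF assms]
  by (simp_all add: vec_eq_iff coord_a_def coord_b_def per_def complex_eq_iff)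

lemma std_frame_per:
  assumes "z \<in> upper_half"
  shows "std_frame z i 1 (per z a b) = of_real (a $ i) + of_real (b $ i) * z $ i"
    and "std_frame z i 2 (per z a b) = of_real (b $ i)"
  using coords_per[OF assms] by (simp_all add: std_frame_def per_def)

section \<open>Calculus of several complex variables\<close>

lemma holo_on_const: "holo_on (\<lambda>_. c) U"
  unfolding holo_on_def by (intro ballI exI[of _ "\<lambda>_. 0"]) auto

lemma holo_on_nth: "holo_on (\<lambda>z. z $ i) U"
  unfolding holo_on_def
  by (intro ballI exI[of _ "\<lambda>h. h $ i"])
    (auto intro: bounded_linear.has_derivative[OF bounded_linear_vec_nth])

lemma holo_on_add:
  assumes "holo_on f U" and "holo_on g U"
  shows "holo_on (\<lambda>z. f z + g z) U"
  unfolding holo_on_def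
proof (intro ballI)
  fix z assume z: "z \<in> U"
  obtain f' where "(f has_derivative f') (at z)" "\<forall>c v. f' (c *s v) = c * f' v"
    using assms(1) z unfolding holo_on_def by blast
  moreover obtain g' where "(g has_derivative g') (at z)" "\<forall>c v. g' (c *s v) = c * g' v"
    using assms(2) z unfolding holo_on_def by blast
  ultimately show "\<exists>h'. ((\<lambda>z. f z + g z) has_derivative h') (at z) \<and> (\<forall>c v. h' (c *s v) = c * h' v)"
    by (intro exI[of _ "\<lambda>h. f' h + g' h"]) (auto intro: has_derivative_add simp: distrib_left)
qed

lemma holo_on_mult:
  assumes "holo_on f U" and "holo_on g U"
  shows "holo_on (\<lambda>z. f z * g z) U"
  unfolding holo_on_def
proof (intro ballI)
  fix z assume z: "z \<in> U"
  obtain f' where "(f has_derivative f') (at z)" "\<forall>c v. f' (c *s v) = c * f' v"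
    using assms(1) z unfolding holo_on_def by blast
  moreover obtain g' where "(g has_derivative g') (at z)" "\<forall>c v. g' (c *s v) = c * g' v"
    using assms(2) z unfolding holo_on_def by blast
  ultimately show "\<exists>h'. ((\<lambda>z. f z * g z) has_derivative h') (at z) \<and> (\<forall>c v. h' (c *s v) = c * h' v)"
    by (intro exI[of _ "\<lambda>h. f z * g' h + f' h * g z"])
      (auto intro: has_derivative_mult simp: algebra_simps)
qed

lemma holo_on_cong:
  assumes "open U" and "\<And>z. z \<in> U \<Longrightarrow> f z = g z" and "holo_on g U"
  shows "holo_on f U"
  unfolding holo_on_def
proof (intro ballI)
  fix z assume z: "z \<in> U"
  obtain g' where g': "(g has_derivative g') (at z)" "\<forall>c v. g' (c *s v) = c * g' v"
    using assms(3) z unfolding holo_on_def by blast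
  have "(f has_derivative g') (at z)"
    using has_derivative_transform_within_open[OF g'(1) assms(1) z] assms(2) by simp
  with g'(2) show "\<exists>f'. (f has_derivative f') (at z) \<and> (\<forall>c v. f' (c *s v) = c * f' v)"
    by blast
qed

lemma has_derivative_vec_lambda:
  fixes y :: "'n::finite \<Rightarrow> complex \<Rightarrow> complex"
  assumes "\<And>i. (y i has_field_derivative y' i) (at t)"
  shows "((\<lambda>t. \<chi> i. y i t) has_derivative (\<lambda>h. \<chi> i. h * y' i)) (at t)"
proof -
  have bl: "bounded_linear (axis i :: complex \<Rightarrow> complex^'n)" for i :: 'n
    by (intro linear_linear[THEN iffD2] linearI) (auto simp: vec_eq_iff axis_def)
  have "((\<lambda>t. \<Sum>i\<in>UNIV. axis i (y i t)) has_derivative (\<lambda>h. \<Sum>i\<in>UNIV. axis i (h * y' i))) (at t)"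
    using assms
    by (intro has_derivative_sum bounded_linear.has_derivative[OF bl])
      (simp add: has_field_derivative_def mult.commute[of "y' _"] mult_commute_abs)
  moreover have "(\<Sum>i\<in>UNIV. axis i (c i)) = (\<chi> i. c i)" for c :: "'n \<Rightarrow> complex"
    by (simp add: vec_eq_iff axis_def)
  ultimately show ?thesis
    by simp
qed

lemma eventually_line_in_open:
  fixes z D :: "complex^'n::finite"
  assumes "open U" and "z \<in> U"
  shows "\<forall>\<^sub>F t in nhds 0. z + t *s D \<in> U"
proof -
  have "continuous_on UNIV (\<lambda>t. \<chi> i. z $ i + t * D $ i)"
    by (intro continuous_intros)
  moreover have "(\<chi> i. z $ i + t * D $ i) = z + t *s D" for t
    by (auto simp: vec_eq_iff)
  ultimately have "open ((\<lambda>t. z + t *s D) -` U)"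
    using assms(1) continuous_on_open_vimage[OF open_UNIV, of "\<lambda>t. z + t *s D"] by simp
  then show ?thesis
    using eventually_nhds_in_open[of "(\<lambda>t. z + t *s D) -` U" 0] assms(2)
    by (simp add: vector_smult_lzero)
qed

lemma holo_on_has_field_derivative_along_line:
  assumes "holo_on g U" and "z \<in> U"
  shows "((\<lambda>t. g (z + t *s D)) has_field_derivative dir_deriv D g z) (at 0)"
proof -
  obtain g' where g': "(g has_derivative g') (at z)" "\<And>c v. g' (c *s v) = c * g' v"
    using assms unfolding holo_on_def by blast
  have "((\<lambda>t. \<chi> i. z $ i + t * D $ i) has_derivative (\<lambda>h. \<chi> i. h * D $ i)) (at 0)"
    by (rule has_derivative_vec_lambda) (auto intro!: derivative_eq_intros)
  moreover have "(\<chi> i. z $ i + t * D $ i) = z + t *s D" and "(\<chi> i. t * D $ i) = t *s D" for t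
    by (auto simp: vec_eq_iff)
  ultimately have "((\<lambda>t. z + t *s D) has_derivative (\<lambda>h. h *s D)) (at 0)"
    by simp
  then have "((\<lambda>t. g (z + t *s D)) has_derivative (\<lambda>h. g' (h *s D))) (at 0)"
    by (rule has_derivative_compose) (use g'(1) in simp)
  then have "((\<lambda>t. g (z + t *s D)) has_field_derivative g' D) (at 0)"
    by (simp add: has_field_derivative_def g'(2) mult_commute_abs)
  then show ?thesis
    unfolding dir_deriv_def by (metis DERIV_imp_deriv)
qed

text \<open>
  The definition of \<^const>\<open>holo_on\<close> supplies some complex linear derivative. Its value at \<open>D\<close> is found by
  restriction to the line through \<open>z\<close> in direction \<open>D\<close>, so the partial derivatives determine it.
\<close>

lemma holo_on_has_derivative:
  fixes g :: "complex^'n::finite \<Rightarrow> complex"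
  assumes "holo_on g U" and "z \<in> U"
  shows "(g has_derivative (\<lambda>h. \<Sum>i\<in>UNIV. h $ i * dir_deriv (axis i 1) g z)) (at z)"
proof -
  obtain g' where g': "(g has_derivative g') (at z)" "\<And>c v. g' (c *s v) = c * g' v"
    using assms unfolding holo_on_def by blast
  have g'_dir: "g' D = dir_deriv D g z" for D
  proof -
    have "((\<lambda>t. z + t *\<^sub>R D) has_derivative (\<lambda>h. h *\<^sub>R D)) (at (0::real))"
      by (auto intro!: derivative_eq_intros)
    then have "((\<lambda>t. g (z + t *\<^sub>R D)) has_derivative (\<lambda>h. g' (h *\<^sub>R D))) (at 0)"
      by (rule has_derivative_compose) (use g'(1) in simp)
    then have "((\<lambda>t. g (z + t *\<^sub>R D)) has_vector_derivative g' D) (at 0)"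
      using linear_scale[OF has_derivative_linear[OF g'(1)]]
      by (simp add: has_vector_derivative_def)
    moreover have "((\<lambda>t. g (z + complex_of_real t *s D)) has_vector_derivative dir_deriv D g z) (at 0)"
      using has_vector_derivative_real_field[of "\<lambda>t. g (z + t *s D)" "dir_deriv D g z" 0]
        holo_on_has_field_derivative_along_line[OF assms, of D] by simp
    moreover have "complex_of_real t *s D = t *\<^sub>R D" for t
      by (auto simp: vec_eq_iff scaleR_conv_of_real[where 'a=complex])
    ultimately show ?thesis
      by (metis (no_types, lifting) ext vector_derivative_at)
  qed
  have "g' = (\<lambda>h. \<Sum>i\<in>UNIV. h $ i * dir_deriv (axis i 1) g z)"
  proof
    fix h :: "complex^'n"
    have "h = (\<Sum>i\<in>UNIV. h $ i *s axis i 1)"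
      by (rule basis_expansion[symmetric])
    then have "g' h = (\<Sum>i\<in>UNIV. g' (h $ i *s axis i 1))"
      by (metis linear_sum[OF has_derivative_linear[OF g'(1)]])
    then show "g' h = (\<Sum>i\<in>UNIV. h $ i * dir_deriv (axis i 1) g z)"
      by (simp add: g'(2) flip: g'_dir)
  qed
  with g'(1) show ?thesis
    by simp
qed

lemma holo_on_chain:
  assumes "holo_on g U" and "\<And>i. (y i has_field_derivative y' i) (at t)" and "(\<chi> i. y i t) \<in> U"
  shows "((\<lambda>t. g (\<chi> i. y i t)) has_field_derivative
           (\<Sum>i\<in>UNIV. y' i * dir_deriv (axis i 1) g (\<chi> i. y i t))) (at t)"
proof -
  have "((\<lambda>t. g (\<chi> i. y i t)) has_derivative
      (\<lambda>h. \<Sum>i\<in>UNIV. (\<chi> i. h * y' i) $ i * dir_deriv (axis i 1) g (\<chi> i. y i t))) (at t)"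
    using has_derivative_vec_lambda[OF assms(2)]
    by (rule has_derivative_compose) (rule holo_on_has_derivative[OF assms(1,3)])
  then show ?thesis
    by (simp add: has_field_derivative_def mult.assoc mult.commute[of _ "(\<Sum>i\<in>UNIV. _ i)"]
        flip: sum_distrib_left)
qed

lemma dir_deriv_eq_sum_axis:
  assumes "holo_on g U" and "z \<in> U"
  shows "dir_deriv D g z = (\<Sum>i\<in>UNIV. D $ i * dir_deriv (axis i 1) g z)"
proof -
  have line: "(\<chi> i. z $ i + t * D $ i) = z + t *s D" for t
    by (auto simp: vec_eq_iff)
  have "((\<lambda>t. z $ i + t * D $ i) has_field_derivative D $ i) (at 0)" for i
    by (auto intro!: derivative_eq_intros)
  from holo_on_chain[of g U "\<lambda>i t. z $ i + t * D $ i", OF assms(1) this]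
  have "((\<lambda>t. g (z + t *s D)) has_field_derivative
      (\<Sum>i\<in>UNIV. D $ i * dir_deriv (axis i 1) g z)) (at 0)"
    using assms(2) unfolding line by (simp add: vector_smult_lzero)
  then show ?thesis
    unfolding dir_deriv_def[of D] by (rule DERIV_imp_deriv)
qed

section \<open>Polynomial families and weight characters\<close>

lemma V_type_imp_holo:
  assumes "P \<in> V_type \<nu>"
  shows "holo_on P UNIV"
  unfolding holo_on_def
proof (intro ballI)
  fix z
  obtain c where P: "P = (\<lambda>Y. \<Sum>m | \<forall>i. m i \<le> \<nu> i. c m * (\<Prod>i\<in>UNIV. (Y $ i) ^ m i))"
    using assms unfolding V_type_def by blast
  let ?P' = "\<lambda>h. \<Sum>m | \<forall>i. m i \<le> \<nu> i. c m *
      (\<Sum>i\<in>UNIV. (of_nat (m i) * h $ i * z $ i ^ (m i - 1)) * (\<Prod>j\<in>UNIV - {i}. z $ j ^ m j))"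
  have "(P has_derivative ?P') (at z)"
    unfolding P
    by (intro has_derivative_sum has_derivative_mult_right has_derivative_prod
          has_derivative_power bounded_linear.has_derivative[OF bounded_linear_vec_nth]
          has_derivative_ident)
  moreover have "?P' (t *s v) = t * ?P' v" for t v
    by (simp add: sum_distrib_left mult_ac)
  ultimately show "\<exists>g'. (P has_derivative g') (at z) \<and> (\<forall>c v. g' (c *s v) = c * g' v)"
    by blast
qed

text \<open>
  The \<open>l p\<close> are the Lagrange polynomials for the nodes \<open>0, \<dots>, n\<close>. Both sides are polynomials of degree
  at most \<open>n\<close> that agree at the \<open>n + 1\<close> nodes.
\<close>

lemma lagrange_basis:
  obtains l :: "nat \<Rightarrow> complex poly"
  where "\<And>x m. m \<le> n \<Longrightarrow> x ^ m = (\<Sum>p\<le>n. of_nat p ^ m * poly (l p) x)"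
proof
  define l :: "nat \<Rightarrow> complex poly"
    where "l = (\<lambda>p. \<Prod>q\<in>{..n} - {p}. smult (1 / (of_nat p - of_nat q)) [:- of_nat q, 1:])"
  have deg: "degree (l p) \<le> n" if "p \<le> n" for p
  proof -
    have "degree (l p) \<le> (\<Sum>q\<in>{..n} - {p}. degree (smult (1 / (of_nat p - of_nat q)) [:- of_nat q, 1 :: complex:]))"
      unfolding l_def
      using degree_prod_sum_le[of "{..n} - {p}"
          "\<lambda>q. smult (1 / (of_nat p - of_nat q)) [:- of_nat q, 1 :: complex:]"]
      by (simp add: o_def)
    also have "\<dots> \<le> (\<Sum>q\<in>{..n} - {p}. 1)"
      by (intro sum_mono) (simp add: degree_smult_le)
    finally show ?thesis
      using that by simp
  qed
  have val: "poly (l p) (of_nat q) = (if q = p then 1 else 0)" if "p \<le> n" "q \<le> n" for p q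
    using that by (auto simp: l_def poly_prod simp flip: diff_divide_distrib)
  have card: "card (of_nat ` {..n} :: complex set) = Suc n"
    by (simp add: card_image inj_on_def)
  show "x ^ m = (\<Sum>p\<le>n. of_nat p ^ m * poly (l p) x)" if "m \<le> n" for x m
  proof -
    have "monom 1 m = (\<Sum>p\<le>n. smult (of_nat p ^ m) (l p))"
    proof (rule poly_eqI_degree)
      show "poly (monom 1 m) x = poly (\<Sum>p\<le>n. smult (of_nat p ^ m) (l p)) x"
        if x: "x \<in> of_nat ` {..n}" for x
      proof -
        obtain q where q: "q \<le> n" "x = of_nat q"
          using x by auto
        have "poly (\<Sum>p\<le>n. smult (of_nat p ^ m) (l p)) x = (\<Sum>p\<le>n. if p = q then x ^ m else 0)"
          unfolding poly_sum by (intro sum.cong) (auto simp: q val)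
        then show ?thesis
          using q by (simp add: poly_monom)
      qed
      show "degree (monom 1 m :: complex poly) < card (of_nat ` {..n} :: complex set)"
        using that card by (simp add: degree_monom_eq)
      have "degree (\<Sum>p\<le>n. smult (of_nat p ^ m) (l p)) \<le> n"
        by (intro degree_sum_le) (auto intro: order_trans[OF degree_smult_le] deg)
      then show "degree (\<Sum>p\<le>n. smult (of_nat p ^ m) (l p)) < card (of_nat ` {..n} :: complex set)"
        using card by simp
    qed
    then have "poly (monom 1 m) x = poly (\<Sum>p\<le>n. smult (of_nat p ^ m) (l p)) x"
      by simp
    then show ?thesis
      by (simp add: poly_monom poly_sum)
  qed
qed

text \<open>
  A polynomial of bounded degrees is a combination of fixed polynomials \<open>L p\<close>, with its own values at
  finitely many points as coefficients. In a family of such polynomials the coefficients therefore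
  depend on the parameter as nicely as the values do. The \<open>L p\<close> are products of Lagrange polynomials, one
  in every variable; for monomials the formula is the product of the formulas in one variable.
\<close>

lemma V_type_interpolation:
  fixes \<nu> :: "'n::finite \<Rightarrow> nat"
  shows "\<exists>L :: ('n \<Rightarrow> nat) \<Rightarrow> complex^'n \<Rightarrow> complex. (\<forall>p. holo_on (L p) UNIV) \<and>
    (\<forall>P\<in>V_type \<nu>. \<forall>Y. P Y = (\<Sum>p | \<forall>i. p i \<le> \<nu> i. P (\<chi> i. of_nat (p i)) * L p Y))"
proof -
  have "\<exists>l :: nat \<Rightarrow> complex poly. \<forall>x m. m \<le> \<nu> i \<longrightarrow> x ^ m = (\<Sum>p\<le>\<nu> i. of_nat p ^ m * poly (l p) x)"
    for i
    by (rule lagrange_basis[of "\<nu> i"]) blast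
  then obtain l :: "'n \<Rightarrow> nat \<Rightarrow> complex poly" where
    l: "\<And>i x m. m \<le> \<nu> i \<Longrightarrow> x ^ m = (\<Sum>p\<le>\<nu> i. of_nat p ^ m * poly (l i p) x)"
    by metis
  define L where "L = (\<lambda>p (Y :: complex^'n). \<Prod>i\<in>UNIV. poly (l i (p i)) (Y $ i))"
  have "holo_on (L p) UNIV" for p
    unfolding holo_on_def
  proof (intro ballI)
    fix z :: "complex^'n"
    have poly_deriv: "((\<lambda>Y :: complex^'n. poly q (Y $ i)) has_derivative (\<lambda>h. h $ i * poly (pderiv q) (z $ i))) (at z)" for q i
      using has_derivative_compose[OF bounded_linear.has_derivative[OF bounded_linear_vec_nth has_derivative_ident]
          poly_DERIV[of q, unfolded has_field_derivative_def], of i z UNIV]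
      by (simp add: mult.commute)
    let ?L' = "\<lambda>h. \<Sum>i\<in>UNIV. (h $ i * poly (pderiv (l i (p i))) (z $ i)) * (\<Prod>j\<in>UNIV - {i}. poly (l j (p j)) (z $ j))"
    have "(L p has_derivative ?L') (at z)"
      unfolding L_def by (intro has_derivative_prod poly_deriv)
    moreover have "?L' (t *s v) = t * ?L' v" for t v
      by (simp add: sum_distrib_left mult_ac)
    ultimately show "\<exists>g'. (L p has_derivative g') (at z) \<and> (\<forall>c v. g' (c *s v) = c * g' v)"
      by blast
  qed
  moreover have "P Y = (\<Sum>p | \<forall>i. p i \<le> \<nu> i. P (\<chi> i. of_nat (p i)) * L p Y)" if V: "P \<in> V_type \<nu>" for P Y
  proof -
    let ?B = "{m. \<forall>i. m i \<le> \<nu> i}"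
    obtain c where P: "\<forall>Y. P Y = (\<Sum>m\<in>?B. c m * (\<Prod>i\<in>UNIV. (Y $ i) ^ m i))"
      using V unfolding V_type_def by blast
    have box: "?B = (\<Pi>\<^sub>E i\<in>UNIV. {..\<nu> i})"
      by auto
    have monomial: "(\<Prod>i\<in>UNIV. (Y $ i) ^ m i) = (\<Sum>p\<in>?B. (\<Prod>i\<in>UNIV. of_nat (p i) ^ m i) * L p Y)"
      if "m \<in> ?B" for m
    proof -
      have "(\<Prod>i\<in>UNIV. (Y $ i) ^ m i) = (\<Prod>i\<in>UNIV. \<Sum>p\<le>\<nu> i. of_nat p ^ m i * poly (l i p) (Y $ i))"
        using that l by (intro prod.cong) auto
      also have "\<dots> = (\<Sum>p\<in>?B. \<Prod>i\<in>UNIV. of_nat (p i) ^ m i * poly (l i (p i)) (Y $ i))"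
        unfolding box by (rule prod_sum_PiE) auto
      finally show ?thesis
        by (simp add: prod.distrib L_def)
    qed
    have "P Y = (\<Sum>m\<in>?B. \<Sum>p\<in>?B. c m * ((\<Prod>i\<in>UNIV. of_nat (p i) ^ m i) * L p Y))"
      unfolding P[rule_format] by (intro sum.cong refl) (simp only: monomial sum_distrib_left)
    also have "\<dots> = (\<Sum>p\<in>?B. \<Sum>m\<in>?B. c m * ((\<Prod>i\<in>UNIV. of_nat (p i) ^ m i) * L p Y))"
      by (rule sum.swap)
    finally show ?thesis
      by (simp add: P sum_distrib_right mult.assoc)
  qed
  ultimately show ?thesis
    by (intro exI[of _ L] conjI allI ballI)
qed

text \<open>
  The chain rule needs differentiability in the parameter and the variable together, while the
  hypotheses concern one of them at a time. By interpolation \<open>P z Y\<close> is a finite sum of products of a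
  function of \<open>z\<close> and a function of \<open>Y\<close>, and the product rule applies to every summand.
\<close>

lemma V_type_family_chain:
  fixes P :: "complex^'n::finite \<Rightarrow> complex^'n \<Rightarrow> complex"
  assumes "\<And>z. z \<in> U \<Longrightarrow> P z \<in> V_type \<nu>" and "\<And>Y. holo_on (\<lambda>z. P z Y) U" and "open U" and "z \<in> U"
    and "\<And>i. (y i has_field_derivative y' i) (at 0)"
  shows "((\<lambda>t. P (z + t *s D) (\<chi> i. y i t)) has_field_derivative
     (dir_deriv D (\<lambda>z. P z (\<chi> i. y i 0)) z
       + (\<Sum>i\<in>UNIV. y' i * dir_deriv (axis i 1) (P z) (\<chi> i. y i 0)))) (at 0)"
proof -
  obtain L :: "('n \<Rightarrow> nat) \<Rightarrow> complex^'n \<Rightarrow> complex"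
    where L_all: "\<forall>p. holo_on (L p) UNIV"
      "\<forall>P\<in>V_type \<nu>. \<forall>Y. P Y = (\<Sum>p | \<forall>i. p i \<le> \<nu> i. P (\<chi> i. of_nat (p i)) * L p Y)"
    using V_type_interpolation[of \<nu>] by (elim exE conjE) (rule that)
  note L = L_all(1)[rule_format] L_all(2)[rule_format]
  let ?B = "{p. \<forall>i. p i \<le> \<nu> i}"
  let ?pt = "\<lambda>p. \<chi> i. complex_of_nat (p i)"
  define y0 where "y0 = (\<chi> i. y i 0)"
  have near: "\<forall>\<^sub>F t in nhds 0. P (z + t *s D) (Y t) = (\<Sum>p\<in>?B. P (z + t *s D) (?pt p) * L p (Y t))"
    for Y
    using eventually_line_in_open[OF assms(3,4), of D] by (rule eventually_mono) (rule L(2)[OF assms(1)])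
  have sum_deriv: "((\<lambda>t. \<Sum>p\<in>?B. P (z + t *s D) (?pt p) * L p (\<chi> i. y i t)) has_field_derivative
      (\<Sum>p\<in>?B. dir_deriv D (\<lambda>z. P z (?pt p)) z * L p y0
         + (\<Sum>i\<in>UNIV. y' i * dir_deriv (axis i 1) (L p) y0) * P z (?pt p))) (at 0)"
  proof (intro DERIV_sum)
    fix p
    show "((\<lambda>t. P (z + t *s D) (?pt p) * L p (\<chi> i. y i t)) has_field_derivative
      dir_deriv D (\<lambda>z. P z (?pt p)) z * L p y0
         + (\<Sum>i\<in>UNIV. y' i * dir_deriv (axis i 1) (L p) y0) * P z (?pt p)) (at 0)"
      using DERIV_mult[OF holo_on_has_field_derivative_along_line[OF assms(2)[of "?pt p"] assms(4), of D]
          holo_on_chain[OF L(1)[of p], of y y' 0, OF assms(5) UNIV_I]]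
      unfolding y0_def by (simp only: vector_smult_lzero add_0_right)
  qed
  have dz: "dir_deriv D (\<lambda>z. P z y0) z = (\<Sum>p\<in>?B. dir_deriv D (\<lambda>z. P z (?pt p)) z * L p y0)"
  proof -
    have "((\<lambda>t. \<Sum>p\<in>?B. P (z + t *s D) (?pt p) * L p y0) has_field_derivative
        (\<Sum>p\<in>?B. dir_deriv D (\<lambda>z. P z (?pt p)) z * L p y0)) (at 0)"
      by (intro DERIV_sum DERIV_cmult_right holo_on_has_field_derivative_along_line[OF assms(2,4)])
    then have "((\<lambda>t. P (z + t *s D) y0) has_field_derivative
        (\<Sum>p\<in>?B. dir_deriv D (\<lambda>z. P z (?pt p)) z * L p y0)) (at 0)"
      by (rule DERIV_cong_ev[OF refl near[of "\<lambda>_. y0"] refl, THEN iffD2])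
    then show ?thesis
      unfolding dir_deriv_def[of D "\<lambda>z. P z y0"] by (rule DERIV_imp_deriv)
  qed
  have dY: "dir_deriv (axis i 1) (P z) y0 = (\<Sum>p\<in>?B. P z (?pt p) * dir_deriv (axis i 1) (L p) y0)" for i
  proof -
    have "((\<lambda>t. \<Sum>p\<in>?B. P z (?pt p) * L p (y0 + t *s axis i 1)) has_field_derivative
        (\<Sum>p\<in>?B. P z (?pt p) * dir_deriv (axis i 1) (L p) y0)) (at 0)"
      by (intro DERIV_sum DERIV_cmult holo_on_has_field_derivative_along_line[OF L(1)]) simp
    moreover have "(\<lambda>t. P z (y0 + t *s axis i 1)) = (\<lambda>t. \<Sum>p\<in>?B. P z (?pt p) * L p (y0 + t *s axis i 1))"
      by (rule ext) (rule L(2)[OF assms(1)[OF \<open>z \<in> U\<close>]])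
    ultimately have "((\<lambda>t. P z (y0 + t *s axis i 1)) has_field_derivative
        (\<Sum>p\<in>?B. P z (?pt p) * dir_deriv (axis i 1) (L p) y0)) (at 0)"
      by (simp only:)
    then show ?thesis
      unfolding dir_deriv_def[of "axis i 1" "P z"] by (rule DERIV_imp_deriv)
  qed
  have "(\<Sum>p\<in>?B. dir_deriv D (\<lambda>z. P z (?pt p)) z * L p y0
         + (\<Sum>i\<in>UNIV. y' i * dir_deriv (axis i 1) (L p) y0) * P z (?pt p))
      = dir_deriv D (\<lambda>z. P z y0) z + (\<Sum>i\<in>UNIV. y' i * dir_deriv (axis i 1) (P z) y0)"
  proof -
    have "(\<Sum>p\<in>?B. (\<Sum>i\<in>UNIV. y' i * dir_deriv (axis i 1) (L p) y0) * P z (?pt p))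
        = (\<Sum>p\<in>?B. \<Sum>i\<in>UNIV. y' i * (P z (?pt p) * dir_deriv (axis i 1) (L p) y0))"
      unfolding sum_distrib_right by (intro sum.cong refl) (simp only: mult_ac)
    also have "\<dots> = (\<Sum>i\<in>UNIV. y' i * dir_deriv (axis i 1) (P z) y0)"
      unfolding dY sum_distrib_left by (rule sum.swap)
    finally show ?thesis
      unfolding dz sum.distrib by simp
  qed
  then have "((\<lambda>t. \<Sum>p\<in>?B. P (z + t *s D) (?pt p) * L p (\<chi> i. y i t)) has_field_derivative
      (dir_deriv D (\<lambda>z. P z y0) z + (\<Sum>i\<in>UNIV. y' i * dir_deriv (axis i 1) (P z) y0))) (at 0)"
    using sum_deriv by (simp only:)
  then show ?thesis
    unfolding y0_def
    by (rule DERIV_cong_ev[OF refl near[of "\<lambda>t. \<chi> i. y i t"] refl, THEN iffD2])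
qed

lemma weight_char_has_field_derivative:
  assumes "\<And>i. (c i has_field_derivative c' i) (at t)" and "\<And>i. c i t \<noteq> 0"
  shows "((\<lambda>t. weight_char \<kappa> (\<chi> i. c i t)) has_field_derivative
           weight_char \<kappa> (\<chi> i. c i t) * (\<Sum>i\<in>UNIV. of_int (\<kappa> i) * c' i / c i t)) (at t)"
proof -
  have pow: "((\<lambda>t. c i t powi \<kappa> i) has_field_derivative of_int (\<kappa> i) * c i t powi (\<kappa> i - 1) * c' i) (at t)" for i
    by (rule DERIV_power_int) (use assms in auto)
  have "(\<Sum>i\<in>UNIV. of_int (\<kappa> i) * c i t powi (\<kappa> i - 1) * c' i / c i t powi \<kappa> i)
      = (\<Sum>i\<in>UNIV. of_int (\<kappa> i) * c' i / c i t)"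
    by (intro sum.cong refl) (use assms(2) in \<open>simp add: power_int_diff\<close>)
  moreover have "((\<lambda>t. \<Prod>i\<in>UNIV. c i t powi \<kappa> i) has_field_derivative (\<Prod>i\<in>UNIV. c i t powi \<kappa> i)
      * (\<Sum>i\<in>UNIV. of_int (\<kappa> i) * c i t powi (\<kappa> i - 1) * c' i / c i t powi \<kappa> i)) (at t)"
    by (rule has_field_derivative_prod'[OF _ pow]) (use assms(2) in simp)
  ultimately show ?thesis
    by (simp only: weight_char_def vec_lambda_beta)
qed

section \<open>Filtered frames\<close>

lemma mat2_nth [simp]:
  "mat2 a b c d $ 1 $ 1 = a" "mat2 a b c d $ 1 $ 2 = b"
  "mat2 a b c d $ 2 $ 1 = c" "mat2 a b c d $ 2 $ 2 = d"
  by (simp_all add: mat2_def)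

lemma matrix_inv_mat2_upper:
  fixes a b d :: complex
  assumes "a \<noteq> 0" and "d \<noteq> 0"
  shows "matrix_inv (mat2 a b 0 d) = mat2 (1 / a) (- b / (a * d)) 0 (1 / d)"
proof -
  let ?A = "mat2 a b 0 d" and ?B = "mat2 (1 / a) (- b / (a * d)) 0 (1 / d)"
  have inv: "?A ** ?B = mat 1" "?B ** ?A = mat 1"
    using assms by (simp_all add: matrix_matrix_mult_def mat_def vec_eq_iff forall_2 sum_2 field_simps)
  then have "?A ** matrix_inv ?A = mat 1"
    unfolding matrix_inv_def by (metis (mono_tags, lifting) someI_ex)
  then show ?thesis
    using matrix_mul_assoc[of ?B ?A "matrix_inv ?A"] inv by simp
qed

lemma open_upper_half:
  fixes U :: "(complex^'n::finite) set"
  defines "U \<equiv> upper_half"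
  shows "open U"
proof -
  have eq: "U = (\<Inter>i. {z. Im (z $ i) > 0})"
    by (auto simp: U_def upper_half_def)
  show ?thesis
    unfolding eq by (intro open_INT ballI finite open_Collect_less continuous_intros)
qed

text \<open>
  The matrix of \<open>\<alpha>\<close> in the basis \<open>(dw, \<beta>)\<close> at \<open>z\<close>, expressed by periods as in \<open>H_comp_expand\<close>. In a
  filtered frame \<open>\<alpha> i 1\<close> is a multiple of \<open>dw\<^sub>i\<close>, whence the zero in the lower left corner.
\<close>

definition frame_matrix :: "complex^'n::finite \<Rightarrow> 'n frame \<Rightarrow> complex^2^2^'n" where
  "frame_matrix z \<alpha> = (\<chi> i. mat2 (\<alpha> i 1 (axis i 1)) (\<alpha> i 2 (axis i 1)) 0
     (\<alpha> i 2 (axis i (z $ i)) - z $ i * \<alpha> i 2 (axis i 1)))"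

lemma frame_eq_std_frame_mult:
  fixes emb :: "'n::finite \<Rightarrow> 'f::field_char_0 \<Rightarrow> real"
  assumes "totally_real_field emb" and "z \<in> upper_half" and "is_frame emb \<alpha>"
  shows "\<alpha> = frame_mult (std_frame z) (frame_matrix z \<alpha>)"
proof (intro ext)
  fix i :: 'n and k :: 2 and v
  have H: "\<alpha> i k \<in> H_comp emb i" and w: "\<alpha> i 1 \<in> omega_comp emb i" for k
    using assms(3) by (auto simp: is_frame_def)
  have "axis i (z $ i) = z $ i *s axis i 1"
    by (simp add: vec_eq_iff axis_def)
  then have "\<alpha> i 1 (axis i (z $ i)) = z $ i * \<alpha> i 1 (axis i 1)"
    using w by (simp add: omega_comp_def)
  then have "\<alpha> i 1 v = std_frame z i 1 v * frame_matrix z \<alpha> $ i $ 1 $ 1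
      + std_frame z i 2 v * frame_matrix z \<alpha> $ i $ 2 $ 1"
    by (subst H_comp_expand[OF assms(1) H[of 1] assms(2)]) (simp add: frame_matrix_def)
  moreover have "\<alpha> i 2 v = std_frame z i 1 v * frame_matrix z \<alpha> $ i $ 1 $ 2
      + std_frame z i 2 v * frame_matrix z \<alpha> $ i $ 2 $ 2"
    by (subst H_comp_expand[OF assms(1) H[of 2] assms(2)]) (simp add: frame_matrix_def)
  ultimately have "\<alpha> i k v = std_frame z i 1 v * frame_matrix z \<alpha> $ i $ 1 $ k
      + std_frame z i 2 v * frame_matrix z \<alpha> $ i $ 2 $ k"
    using exhaust_2[of k] by metis
  then show "\<alpha> i k v = frame_mult (std_frame z) (frame_matrix z \<alpha>) i k v"
    by (simp add: frame_mult_def sum_2)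
qed

text \<open>
  A zero on the diagonal would make \<open>\<alpha> i 1\<close> and \<open>\<alpha> i 2\<close> linearly dependent, against the uniqueness of
  the coordinates of the zero functional.
\<close>

lemma frame_matrix_in_borel_group:
  fixes emb :: "'n::finite \<Rightarrow> 'f::field_char_0 \<Rightarrow> real"
  assumes "totally_real_field emb" and "z \<in> upper_half" and "is_frame emb \<alpha>"
  shows "frame_matrix z \<alpha> \<in> borel_group"
proof -
  define g where "g = frame_matrix z \<alpha>"
  have eq: "\<alpha> = frame_mult (std_frame z) g" and g21: "g $ i $ 2 $ 1 = 0" for i
    unfolding g_def by (rule frame_eq_std_frame_mult[OF assms]) (simp add: frame_matrix_def)
  have \<alpha>: "\<alpha> i 1 v = std_frame z i 1 v * g $ i $ 1 $ 1"
    "\<alpha> i 2 v = std_frame z i 1 v * g $ i $ 1 $ 2 + std_frame z i 2 v * g $ i $ 2 $ 2" for i v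
    by (simp_all add: eq frame_mult_def sum_2 g21)
  have "g $ i $ 1 $ 1 \<noteq> 0" and "g $ i $ 2 $ 2 \<noteq> 0" for i
  proof -
    have zero: "(\<lambda>_. 0) \<in> H_comp emb i"
      by (auto simp: H_comp_def intro: linearI)
    have "\<exists>!c::complex^2. (\<lambda>_. 0) = (\<lambda>v. \<Sum>k\<in>UNIV. c $ k * \<alpha> i k v)"
      using assms(3) zero unfolding is_frame_def by blast
    moreover have "(\<lambda>_. 0) = (\<lambda>v. \<Sum>k\<in>UNIV. (0 :: complex^2) $ k * \<alpha> i k v)"
      by simp
    ultimately have unique: "c = 0" if "(\<lambda>_. 0) = (\<lambda>v. \<Sum>k\<in>UNIV. c $ k * \<alpha> i k v)" for c :: "complex^2"
      using that by blast
    have ind: "c = 0" if "\<And>v. c $ 1 * \<alpha> i 1 v + c $ 2 * \<alpha> i 2 v = 0" for c :: "complex^2"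
      by (rule unique) (simp add: sum_2 that)
    show "g $ i $ 1 $ 1 \<noteq> 0"
      using ind[of "vector [1, 0]"] by (auto simp: \<alpha> vec_eq_iff forall_2)
    show "g $ i $ 2 $ 2 \<noteq> 0"
      using ind[of "vector [g $ i $ 1 $ 2, - g $ i $ 1 $ 1]"] \<open>g $ i $ 1 $ 1 \<noteq> 0\<close>
      by (auto simp: \<alpha> vec_eq_iff forall_2 algebra_simps)
  qed
  then show ?thesis
    by (simp add: borel_group_def g21 flip: g_def)
qed

text \<open>
  Coordinates with respect to the new frame solve a triangular system with invertible diagonal. The
  system arises by evaluation at the periods \<open>1\<close> and \<open>z\<^sub>i\<close>, and \<open>(x, y)\<close> in the proof is its solution.
\<close>

lemma is_frame_std_frame_mult:
  fixes emb :: "'n::finite \<Rightarrow> 'f::field_char_0 \<Rightarrow> real"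
  assumes "totally_real_field emb" and z: "z \<in> upper_half" and g: "g \<in> borel_group"
  shows "is_frame emb (frame_mult (std_frame z) g)"
proof -
  define \<alpha> where "\<alpha> = frame_mult (std_frame z) g"
  have \<alpha>1: "\<alpha> i 1 v = std_frame z i 1 v * g $ i $ 1 $ 1"
    and \<alpha>2: "\<alpha> i 2 v = std_frame z i 1 v * g $ i $ 1 $ 2 + std_frame z i 2 v * g $ i $ 2 $ 2"
    and nz: "g $ i $ 1 $ 1 \<noteq> 0" "g $ i $ 2 $ 2 \<noteq> 0" for i v
    using g by (simp_all add: \<alpha>_def frame_mult_def sum_2 borel_group_def)
  have comb: "(\<lambda>v. std_frame z i 1 v * x + std_frame z i 2 v * y) \<in> H_comp emb i" for i x y
  proof -
    have lin: "linear (std_frame z i k)" for k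
      using std_frame_in_H_comp[of z i k emb] by (simp add: H_comp_def)
    have "linear (\<lambda>v. std_frame z i 1 v * x + std_frame z i 2 v * y)"
      by (rule linearI)
        (simp_all add: linear_add[OF lin] linear_scale[OF lin] algebra_simps scaleR_conv_of_real[where 'a=complex])
    moreover have "std_frame z i k (of_action emb a v) = of_real (emb i a) * std_frame z i k v"
      if "a \<in> ring_of_integers" for a v k
      using std_frame_in_H_comp[of z i k emb] that by (simp add: H_comp_def)
    ultimately show ?thesis
      by (simp add: H_comp_def distrib_left mult.assoc)
  qed
  have H: "\<alpha> i k \<in> H_comp emb i" for i k
  proof -
    have "\<alpha> i 1 = (\<lambda>v. std_frame z i 1 v * g $ i $ 1 $ 1 + std_frame z i 2 v * 0)"
      and "\<alpha> i 2 = (\<lambda>v. std_frame z i 1 v * g $ i $ 1 $ 2 + std_frame z i 2 v * g $ i $ 2 $ 2)"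
      by (simp_all add: \<alpha>1 \<alpha>2 fun_eq_iff)
    then have "\<alpha> i 1 \<in> H_comp emb i" and "\<alpha> i 2 \<in> H_comp emb i"
      using comb[of i "g $ i $ 1 $ 1" 0] comb[of i "g $ i $ 1 $ 2" "g $ i $ 2 $ 2"]
      by (simp_all only:)
    then show ?thesis
      using exhaust_2[of k] by auto
  qed
  have w: "\<alpha> i 1 \<in> omega_comp emb i" for i
    using H[of i 1] std_frame_1_in_omega_comp[of z i emb] by (simp add: omega_comp_def \<alpha>1)
  have ex1_H: "\<exists>!c::complex^2. \<eta> = (\<lambda>v. \<Sum>k\<in>UNIV. c $ k * \<alpha> i k v)" if "\<eta> \<in> H_comp emb i" for i \<eta>
  proof -
    define y where "y = (\<eta> (axis i (z $ i)) - z $ i * \<eta> (axis i 1)) / g $ i $ 2 $ 2"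
    define x where "x = (\<eta> (axis i 1) - g $ i $ 1 $ 2 * y) / g $ i $ 1 $ 1"
    show ?thesis
    proof
      show "\<eta> = (\<lambda>v. \<Sum>k\<in>UNIV. (vector [x, y] :: complex^2) $ k * \<alpha> i k v)"
      proof
        fix v
        have 1: "\<eta> (axis i 1) = x * g $ i $ 1 $ 1 + y * g $ i $ 1 $ 2"
          and 2: "\<eta> (axis i (z $ i)) - z $ i * \<eta> (axis i 1) = y * g $ i $ 2 $ 2"
          using nz[of i] by (simp_all add: x_def y_def)
        show "\<eta> v = (\<Sum>k\<in>UNIV. (vector [x, y] :: complex^2) $ k * \<alpha> i k v)"
          using fun_cong[OF H_comp_expand[OF assms(1) that z], of v]
          unfolding 2 unfolding 1 by (simp add: sum_2 \<alpha>1 \<alpha>2 algebra_simps)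
      qed
    next
      fix c :: "complex^2"
      assume "\<eta> = (\<lambda>v. \<Sum>k\<in>UNIV. c $ k * \<alpha> i k v)"
      then have \<eta>1: "\<eta> (axis i 1) = c $ 1 * g $ i $ 1 $ 1 + c $ 2 * g $ i $ 1 $ 2"
        and \<eta>z: "\<eta> (axis i (z $ i)) = c $ 1 * (z $ i * g $ i $ 1 $ 1)
               + c $ 2 * (z $ i * g $ i $ 1 $ 2 + g $ i $ 2 $ 2)"
        by (simp_all add: sum_2 \<alpha>1 \<alpha>2 std_frame_axis[OF z])
      have "\<eta> (axis i (z $ i)) - z $ i * \<eta> (axis i 1) = c $ 2 * g $ i $ 2 $ 2"
        unfolding \<eta>1 \<eta>z by (simp add: algebra_simps)
      then have y: "c $ 2 = y"
        using nz[of i] by (simp add: y_def)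
      have "\<eta> (axis i 1) - g $ i $ 1 $ 2 * y = c $ 1 * g $ i $ 1 $ 1"
        unfolding \<eta>1 y by (simp add: algebra_simps)
      then have "c $ 1 = x"
        using nz[of i] by (simp add: x_def)
      with y show "c = vector [x, y]"
        by (simp add: vec_eq_iff forall_2)
    qed
  qed
  have ex1_w: "\<exists>!c. \<eta> = (\<lambda>v. c * \<alpha> i 1 v)" if "\<eta> \<in> omega_comp emb i" for i \<eta>
  proof
    have "axis i (z $ i) = z $ i *s axis i 1"
      by (simp add: vec_eq_iff axis_def)
    then have "\<eta> (axis i (z $ i)) = z $ i * \<eta> (axis i 1)"
      using that by (simp add: omega_comp_def)
    moreover have "\<eta> \<in> H_comp emb i"
      using that by (simp add: omega_comp_def)
    ultimately have expand: "\<eta> v = std_frame z i 1 v * \<eta> (axis i 1)" for v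
      using fun_cong[OF H_comp_expand[OF assms(1) _ z], of \<eta> i v] by simp
    show "\<eta> = (\<lambda>v. \<eta> (axis i 1) / g $ i $ 1 $ 1 * \<alpha> i 1 v)"
    proof
      fix v
      show "\<eta> v = \<eta> (axis i 1) / g $ i $ 1 $ 1 * \<alpha> i 1 v"
        using expand[of v] nz[of i] by (simp add: \<alpha>1)
    qed
  next
    fix c
    assume "\<eta> = (\<lambda>v. c * \<alpha> i 1 v)"
    then show "c = \<eta> (axis i 1) / g $ i $ 1 $ 1"
      using nz[of i] by (simp add: \<alpha>1 std_frame_axis[OF z])
  qed
  show ?thesis
    unfolding is_frame_def \<alpha>_def[symmetric] by (intro allI conjI ballI H w ex1_H ex1_w)
qed

text \<open>
  For constant \<open>g\<close> the periods along constant lattice vectors are affine functions of \<open>z\<close>. These frames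
  show that holomorphic frames exist through every given frame at a point.
\<close>

lemma local_frame_std_frame_mult:
  fixes emb :: "'n::finite \<Rightarrow> 'f::field_char_0 \<Rightarrow> real"
  assumes "totally_real_field emb" and g: "g \<in> borel_group"
  shows "local_frame emb upper_half (\<lambda>z. frame_mult (std_frame z) g)"
proof -
  have "holo_on (\<lambda>z. frame_mult (std_frame z) g i k (per z a b)) upper_half" for i k a b
  proof (rule holo_on_cong[OF open_upper_half])
    show "frame_mult (std_frame z) g i k (per z a b)
        = (of_real (a $ i) + of_real (b $ i) * z $ i) * g $ i $ 1 $ k + of_real (b $ i) * g $ i $ 2 $ k"
      if "z \<in> upper_half" for z
      using that by (simp add: frame_mult_def sum_2 std_frame_per)
  qed (intro holo_on_add holo_on_mult holo_on_const holo_on_nth)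
  then show ?thesis
    using is_frame_std_frame_mult[OF assms(1) _ g] open_upper_half by (auto simp: local_frame_def)
qed

text \<open>
  The periods \<open>1\<close> and \<open>z\<^sub>i\<close> that enter the matrix are the values of \<open>per z\<close> at constant arguments, where a
  holomorphic frame is holomorphic by definition.
\<close>

lemma local_frame_frame_matrix_holo:
  fixes emb :: "'n::finite \<Rightarrow> 'f::field_char_0 \<Rightarrow> real"
  assumes "local_frame emb U \<alpha>"
  shows "holo_on (\<lambda>z. frame_matrix z (\<alpha> z) $ i $ l $ k) U"
proof -
  have per_axis: "per z (axis i 1) 0 = axis i 1" "per z 0 (axis i 1) = axis i (z $ i)" for z :: "complex^'n"
    by (auto simp: per_def vec_eq_iff axis_def)
  have hol: "holo_on (\<lambda>z. \<alpha> z i k (per z a b)) U" for k a b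
    using assms by (simp add: local_frame_def)
  have 1: "holo_on (\<lambda>z. \<alpha> z i k (axis i 1)) U" for k
    using hol[of k "axis i 1" 0] by (simp add: per_axis)
  have 2: "holo_on (\<lambda>z. \<alpha> z i k (axis i (z $ i)) + (- 1) * (z $ i * \<alpha> z i k (axis i 1))) U" for k
    using hol[of k 0 "axis i 1"]
    by (intro holo_on_add holo_on_mult holo_on_const holo_on_nth 1) (simp add: per_axis)
  show ?thesis
    using exhaust_2[of l] exhaust_2[of k] 1 2 by (auto simp: frame_matrix_def holo_on_const)
qed

lemma frame_mult_mat_1: "frame_mult \<alpha> (\<chi> i. mat 1) = \<alpha>"
proof (intro ext)
  fix i k v
  show "frame_mult \<alpha> (\<chi> i. mat 1) i k v = \<alpha> i k v"
    using exhaust_2[of k] by (auto simp: frame_mult_def sum_2 mat_def)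
qed

lemma one_in_borel_group: "(\<chi> i. mat 1) \<in> borel_group"
  by (simp add: borel_group_def mat_def)

lemma is_frame_std_frame:
  assumes "totally_real_field emb" and "z \<in> upper_half"
  shows "is_frame emb (std_frame z)"
  using is_frame_std_frame_mult[OF assms one_in_borel_group]
  by (simp only: frame_mult_mat_1)

lemma local_frame_std_frame:
  assumes "totally_real_field emb"
  shows "local_frame emb upper_half std_frame"
  using local_frame_std_frame_mult[OF assms one_in_borel_group]
  by (simp only: frame_mult_mat_1)

lemma frame_matrix_std_frame_mult:
  assumes "z \<in> upper_half" and "g \<in> borel_group"
  shows "frame_matrix z (frame_mult (std_frame z) g) = g"
  using assms(2) by (simp add: frame_matrix_def frame_mult_def sum_2 std_frame_axis[OF assms(1)]
      borel_group_def vec_eq_iff forall_2)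

text \<open>
  The change of basis from \<open>(dw, \<beta>)\<close> to \<open>(dw, \<beta> - s dw)\<close>, through which the splitting of the Hodge
  filtration by the antiholomorphic forms is reached from the holomorphic frame.
\<close>

definition shear :: "complex^'n::finite \<Rightarrow> complex^2^2^'n" where
  "shear s = (\<chi> i. mat2 1 (- s $ i) 0 1)"

lemma shear_in_borel_group: "shear s \<in> borel_group"
  by (simp add: shear_def borel_group_def)

lemma ms_frame_eq_shear:
  assumes "z \<in> upper_half"
  shows "ms_frame z = frame_mult (std_frame z) (shear (s_fun z))"
proof (intro ext)
  fix i :: 'a and k :: 2 and v
  have Im: "Im (z $ i) \<noteq> 0"
    by (rule upper_half_Im_nonzero[OF assms])
  then have nz: "z $ i - cnj (z $ i) \<noteq> 0"
    by (simp add: complex_eq_iff)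
  have "v $ i - cnj (v $ i) = of_real (coord_b z v $ i) * (z $ i - cnj (z $ i))"
    using Im by (simp add: coord_b_def complex_eq_iff)
  then have "- cnj (v $ i) * s_fun z $ i = - v $ i * s_fun z $ i + of_real (coord_b z v $ i)"
    using nz by (simp add: s_fun_def field_simps)
  then show "ms_frame z i k v = frame_mult (std_frame z) (shear (s_fun z)) i k v"
    using exhaust_2[of k] by (auto simp: ms_frame_def frame_mult_def sum_2 std_frame_def shear_def)
qed

section \<open>The connection at sheared frames\<close>

text \<open>
  With \<open>\<alpha> = (dw, \<beta>) g\<close> this is the Leibniz rule, given that \<open>\<nabla>(dw\<^sub>i) = \<beta>\<^sub>i dz\<^sub>i\<close> and \<open>\<nabla>(\<beta>\<^sub>i) = 0\<close>.
\<close>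

lemma gauss_manin_frame:
  fixes emb :: "'n::finite \<Rightarrow> 'f::field_char_0 \<Rightarrow> real"
  assumes "totally_real_field emb" and \<alpha>: "local_frame emb U \<alpha>" and "z \<in> U"
  shows "gauss_manin D (\<lambda>z'. \<alpha> z' i k) z v =
      std_frame z i 1 v * dir_deriv D (\<lambda>z'. frame_matrix z' (\<alpha> z') $ i $ 1 $ k) z
    + std_frame z i 2 v * (D $ i * frame_matrix z (\<alpha> z) $ i $ 1 $ k
        + dir_deriv D (\<lambda>z'. frame_matrix z' (\<alpha> z') $ i $ 2 $ k) z)"
proof -
  let ?g = "\<lambda>z l. frame_matrix z (\<alpha> z) $ i $ l $ k"
  define a where "a = coord_a z v"
  define b where "b = coord_b z v"
  have U: "open U" "U \<subseteq> upper_half"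
    using \<alpha> by (auto simp: local_frame_def)
  have expand: "\<alpha> z' i k (per z' a b)
      = (of_real (a $ i) + of_real (b $ i) * z' $ i) * ?g z' 1 + of_real (b $ i) * ?g z' 2"
    if "z' \<in> U" for z'
  proof -
    have "is_frame emb (\<alpha> z')" and z': "z' \<in> upper_half"
      using that \<alpha> by (auto simp: local_frame_def)
    then have "\<alpha> z' = frame_mult (std_frame z') (frame_matrix z' (\<alpha> z'))"
      by (intro frame_eq_std_frame_mult[OF assms(1)])
    then have "\<alpha> z' i k (per z' a b) = frame_mult (std_frame z') (frame_matrix z' (\<alpha> z')) i k (per z' a b)"
      by (rule fun_cong[OF fun_cong[OF fun_cong]])
    then show ?thesis
      by (simp add: frame_mult_def sum_2 std_frame_per[OF z'])
  qed
  have near: "\<forall>\<^sub>F t in nhds 0. \<alpha> (z + t *s D) i k (per (z + t *s D) a b)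
      = (of_real (a $ i) + of_real (b $ i) * (z $ i + t * D $ i)) * ?g (z + t *s D) 1
        + of_real (b $ i) * ?g (z + t *s D) 2"
    using eventually_line_in_open[OF U(1) \<open>z \<in> U\<close>, of D]
    by (rule eventually_mono) (simp add: expand)
  have gder: "((\<lambda>t. ?g (z + t *s D) l) has_field_derivative dir_deriv D (\<lambda>z'. ?g z' l) z) (at 0)" for l
    by (rule holo_on_has_field_derivative_along_line[OF local_frame_frame_matrix_holo[OF \<alpha>] \<open>z \<in> U\<close>])
  have "((\<lambda>t. (of_real (a $ i) + of_real (b $ i) * (z $ i + t * D $ i)) * ?g (z + t *s D) 1
        + of_real (b $ i) * ?g (z + t *s D) 2) has_field_derivative
      (of_real (a $ i) + of_real (b $ i) * z $ i) * dir_deriv D (\<lambda>z'. ?g z' 1) z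
      + of_real (b $ i) * D $ i * ?g z 1 + of_real (b $ i) * dir_deriv D (\<lambda>z'. ?g z' 2) z) (at 0)"
    by (rule derivative_eq_intros gder refl | simp add: vector_smult_lzero algebra_simps)+
  then have "((\<lambda>t. \<alpha> (z + t *s D) i k (per (z + t *s D) a b)) has_field_derivative
      (of_real (a $ i) + of_real (b $ i) * z $ i) * dir_deriv D (\<lambda>z'. ?g z' 1) z
      + of_real (b $ i) * D $ i * ?g z 1 + of_real (b $ i) * dir_deriv D (\<lambda>z'. ?g z' 2) z) (at 0)"
    by (rule DERIV_cong_ev[OF refl near refl, THEN iffD2])
  then have "gauss_manin D (\<lambda>z'. \<alpha> z' i k) z v =
      (of_real (a $ i) + of_real (b $ i) * z $ i) * dir_deriv D (\<lambda>z'. ?g z' 1) z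
      + of_real (b $ i) * D $ i * ?g z 1 + of_real (b $ i) * dir_deriv D (\<lambda>z'. ?g z' 2) z"
    unfolding gauss_manin_def dir_deriv_def[of D "\<lambda>z'. \<alpha> z' i k (per z' _ _)"] a_def b_def
    by (rule DERIV_imp_deriv)
  moreover have "std_frame z i 1 v = of_real (a $ i) + of_real (b $ i) * z $ i"
    and "std_frame z i 2 v = of_real (b $ i)"
  proof -
    have z: "z \<in> upper_half"
      using U \<open>z \<in> U\<close> by blast
    show "std_frame z i 1 v = of_real (a $ i) + of_real (b $ i) * z $ i"
      using std_frame_per(1)[OF z, of i a b] per_coords[OF z, of v] by (simp add: a_def b_def)
    show "std_frame z i 2 v = of_real (b $ i)"
      by (simp add: std_frame_def b_def)
  qed
  ultimately show ?thesis
    by (simp add: algebra_simps)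
qed

text \<open>
  Where \<open>g = shear s\<close>, the matrix is \<open>g\<^sup>-\<^sup>1 g' + g\<^sup>-\<^sup>1 n g\<close> with \<open>n\<close> the matrix of the connection in the frame
  \<open>(dw, \<beta>)\<close>, whose only nonzero entry is \<open>D\<^sub>i\<close> in the lower left corner. It is unique because the frame at
  \<open>z\<close> is a basis, as evaluation at the two periods shows.
\<close>

lemma conn_matrix_at_shear:
  fixes emb :: "'n::finite \<Rightarrow> 'f::field_char_0 \<Rightarrow> real" and D :: "complex^'n"
  assumes "totally_real_field emb" and \<alpha>: "local_frame emb U \<alpha>" and "z \<in> U"
    and at_z: "\<alpha> z = frame_mult (std_frame z) (shear s)"
  defines "g' \<equiv> \<lambda>i l k. dir_deriv D (\<lambda>z'. frame_matrix z' (\<alpha> z') $ i $ l $ k) z"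
  shows "conn_matrix D \<alpha> z = (\<chi> i. mat2 (g' i 1 1 + s $ i * D $ i)
     (g' i 1 2 + s $ i * (g' i 2 2 - s $ i * D $ i)) (D $ i) (g' i 2 2 - s $ i * D $ i))" (is "_ = ?X")
proof -
  have z: "z \<in> upper_half"
    using \<alpha> \<open>z \<in> U\<close> by (auto simp: local_frame_def)
  have g: "frame_matrix z (\<alpha> z) = shear s"
    unfolding at_z by (rule frame_matrix_std_frame_mult[OF z shear_in_borel_group])
  have g'21: "g' i 2 1 = 0" for i
    by (simp add: g'_def dir_deriv_def frame_matrix_def)
  have gm: "gauss_manin D (\<lambda>z'. \<alpha> z' i k) z v = std_frame z i 1 v * g' i 1 k
      + std_frame z i 2 v * (D $ i * shear s $ i $ 1 $ k + g' i 2 k)" for i k v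
    unfolding gauss_manin_frame[OF assms(1-3)] g g'_def ..
  have comb: "(\<Sum>l\<in>UNIV. \<alpha> z i l v * X $ i $ l $ k) = std_frame z i 1 v * (X $ i $ 1 $ k - s $ i * X $ i $ 2 $ k)
      + std_frame z i 2 v * X $ i $ 2 $ k" for X :: "complex^2^2^'n" and i k v
    unfolding at_z by (simp add: frame_mult_def sum_2 shear_def algebra_simps)
  show ?thesis
    unfolding conn_matrix_def
  proof (rule the_equality)
    show "\<forall>i k. gauss_manin D (\<lambda>z'. \<alpha> z' i k) z = (\<lambda>v. \<Sum>l\<in>UNIV. \<alpha> z i l v * ?X $ i $ l $ k)"
    proof (intro allI ext)
      fix i and k :: 2 and v
      show "gauss_manin D (\<lambda>z'. \<alpha> z' i k) z v = (\<Sum>l\<in>UNIV. \<alpha> z i l v * ?X $ i $ l $ k)"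
        using exhaust_2[of k] unfolding gm comb by (auto simp: shear_def g'21)
    qed
  next
    fix X
    assume X: "\<forall>i k. gauss_manin D (\<lambda>z'. \<alpha> z' i k) z = (\<lambda>v. \<Sum>l\<in>UNIV. \<alpha> z i l v * X $ i $ l $ k)"
    have eq: "std_frame z i 1 v * (X $ i $ 1 $ k - s $ i * X $ i $ 2 $ k) + std_frame z i 2 v * X $ i $ 2 $ k
        = std_frame z i 1 v * g' i 1 k + std_frame z i 2 v * (D $ i * shear s $ i $ 1 $ k + g' i 2 k)" for i k v
      using fun_cong[OF X[rule_format], of i k v] unfolding gm comb by simp
    have 1: "X $ i $ 1 $ k - s $ i * X $ i $ 2 $ k = g' i 1 k" for i k
      using eq[of i "axis i 1" k] by (simp add: std_frame_axis[OF z])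
    have 2: "X $ i $ 2 $ k = D $ i * shear s $ i $ 1 $ k + g' i 2 k" for i k
      using eq[of i "axis i (z $ i)" k] by (simp add: std_frame_axis[OF z] 1)
    have "X $ i $ 1 $ k = g' i 1 k + s $ i * (D $ i * shear s $ i $ 1 $ k + g' i 2 k)" for i k
      using 1[of i k] unfolding 2 by (simp add: algebra_simps)
    with 2 show "X = ?X"
      by (simp add: vec_eq_iff forall_2 shear_def g'21 algebra_simps)
  qed
qed

lemma section_frame_mult:
  assumes "section_on_Y emb N \<kappa> \<nu> f" and "z \<in> upper_half" and "is_frame emb \<alpha>" and "g \<in> borel_group"
  shows "f z (frame_mult \<alpha> g) Y = weight_char \<kappa> (\<chi> i. 1 / g $ i $ 1 $ 1)
           * f z \<alpha> (\<chi> i. (g $ i $ 1 $ 1 * Y $ i - g $ i $ 1 $ 2) / g $ i $ 2 $ 2)"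
proof -
  have nz: "g $ i $ 1 $ 1 \<noteq> 0" "g $ i $ 2 $ 2 \<noteq> 0" and upper: "g $ i $ 2 $ 1 = 0" for i
    using assms(4) by (auto simp: borel_group_def)
  have "g $ i = mat2 (g $ i $ 1 $ 1) (g $ i $ 1 $ 2) 0 (g $ i $ 2 $ 2)" for i
    by (simp add: vec_eq_iff forall_2 upper)
  then have inv: "matrix_inv (g $ i) = mat2 (1 / g $ i $ 1 $ 1)
      (- g $ i $ 1 $ 2 / (g $ i $ 1 $ 1 * g $ i $ 2 $ 2)) 0 (1 / g $ i $ 2 $ 2)" for i
    using matrix_inv_mat2_upper[OF nz] by metis
  have arg: "inverse (1 / g $ i $ 1 $ 1) * (- g $ i $ 1 $ 2 / (g $ i $ 1 $ 1 * g $ i $ 2 $ 2)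
      + Y $ i * (1 / g $ i $ 2 $ 2)) = (g $ i $ 1 $ 1 * Y $ i - g $ i $ 1 $ 2) / g $ i $ 2 $ 2" for i
    using nz[of i] by (simp add: field_simps)
  have "f z (frame_mult \<alpha> g) = Q_act \<kappa> (\<chi> i. matrix_inv (g $ i)) (f z \<alpha>)"
    using assms by (simp add: section_on_Y_def)
  then show ?thesis
    by (simp only: Q_act_def vec_lambda_beta inv mat2_nth arg)
qed

lemma section_family:
  assumes "totally_real_field emb" and "section_on_Y emb N \<kappa> \<nu> f"
  shows "z \<in> upper_half \<Longrightarrow> f z (std_frame z) \<in> V_type \<nu>"
    and "holo_on (\<lambda>z. f z (std_frame z) Y) upper_half"
  using assms is_frame_std_frame local_frame_std_frame unfolding section_on_Y_def by blast+

lemma section_at_shear: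
  assumes "totally_real_field emb" and "section_on_Y emb N \<kappa> \<nu> f" and "z \<in> upper_half"
  shows "f z (frame_mult (std_frame z) (shear s)) Y = f z (std_frame z) (Y + s)"
proof -
  have "(\<chi> i. Y $ i + s $ i) = Y + s"
    by (simp add: vec_eq_iff)
  then show ?thesis
    using section_frame_mult[OF assms(2,3) is_frame_std_frame[OF assms(1,3)] shear_in_borel_group, of s Y]
    by (simp add: shear_def weight_char_def)
qed

lemma q_act_eq:
  assumes "holo_on P UNIV"
  shows "q_act \<kappa> X P Y = (\<Sum>i\<in>UNIV. of_int (\<kappa> i) * X $ i $ 1 $ 1) * P Y
     + (\<Sum>i\<in>UNIV. (X $ i $ 1 $ 2 + Y $ i * X $ i $ 2 $ 2 - Y $ i * X $ i $ 1 $ 1) * dir_deriv (axis i 1) P Y)"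
proof -
  let ?a = "\<lambda>i t. 1 + t * X $ i $ 1 $ 1"
  let ?y = "\<lambda>i t. inverse (?a i t) * (t * X $ i $ 1 $ 2 + Y $ i * (1 + t * X $ i $ 2 $ 2))"
  have y: "(?y i has_field_derivative X $ i $ 1 $ 2 + Y $ i * X $ i $ 2 $ 2 - Y $ i * X $ i $ 1 $ 1) (at 0)" for i
    by (rule derivative_eq_intros refl | simp)+
  have a: "(?a i has_field_derivative X $ i $ 1 $ 1) (at 0)" for i
    by (rule derivative_eq_intros refl | simp)+
  have "((\<lambda>t. weight_char \<kappa> (\<chi> i. ?a i t) * P (\<chi> i. ?y i t)) has_field_derivative
     (\<Sum>i\<in>UNIV. of_int (\<kappa> i) * X $ i $ 1 $ 1) * P Y
     + (\<Sum>i\<in>UNIV. (X $ i $ 1 $ 2 + Y $ i * X $ i $ 2 $ 2 - Y $ i * X $ i $ 1 $ 1) * dir_deriv (axis i 1) P Y)) (at 0)"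
    using DERIV_mult[OF weight_char_has_field_derivative[of ?a, OF a] holo_on_chain[OF assms, of ?y, OF y UNIV_I], of \<kappa>]
    by (simp add: weight_char_def add.commute)
  moreover have "Q_act \<kappa> (\<chi> i. mat 1 + (\<chi> j k. t * X $ i $ j $ k)) P Y
      = weight_char \<kappa> (\<chi> i. ?a i t) * P (\<chi> i. ?y i t)" for t
    by (simp add: Q_act_def mat_def)
  ultimately show ?thesis
    unfolding q_act_def by (simp add: DERIV_imp_deriv)
qed

lemma dir_deriv_translate: "dir_deriv D (\<lambda>Y. P (Y + s)) Y = dir_deriv D P (Y + s)"
  by (simp add: dir_deriv_def ac_simps)

text \<open>
  Equivariance expresses \<open>f\<close> along the frame \<open>(dw, \<beta>) g(z)\<close> as \<open>\<kappa>(g\<^sub>1\<^sub>1\<^sup>-\<^sup>1) P\<^sub>z((g\<^sub>1\<^sub>1 Y - g\<^sub>1\<^sub>2) / g\<^sub>2\<^sub>2)\<close>. The three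
  terms are its derivatives through \<open>P\<^sub>z\<close>, through the weight and through the argument, at a point where
  \<open>g\<close> is a shear.
\<close>

lemma section_dir_deriv_at_shear:
  fixes emb :: "'n::finite \<Rightarrow> 'f::field_char_0 \<Rightarrow> real" and D :: "complex^'n"
  assumes "totally_real_field emb" and f: "section_on_Y emb N \<kappa> \<nu> f"
    and \<alpha>: "local_frame emb U \<alpha>" and "z \<in> U" and at_z: "\<alpha> z = frame_mult (std_frame z) (shear s)"
  defines "g' \<equiv> \<lambda>i l k. dir_deriv D (\<lambda>z'. frame_matrix z' (\<alpha> z') $ i $ l $ k) z"
  shows "dir_deriv D (\<lambda>z'. f z' (\<alpha> z') Y) z = dir_deriv D (\<lambda>z'. f z' (std_frame z') (Y + s)) z
    - (\<Sum>i\<in>UNIV. of_int (\<kappa> i) * g' i 1 1) * f z (std_frame z) (Y + s)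
    + (\<Sum>i\<in>UNIV. (g' i 1 1 * Y $ i - g' i 1 2 - g' i 2 2 * (Y $ i + s $ i))
          * dir_deriv (axis i 1) (f z (std_frame z)) (Y + s))"
proof -
  have U: "open U" "U \<subseteq> upper_half"
    using \<alpha> by (auto simp: local_frame_def)
  have z: "z \<in> upper_half"
    using U \<open>z \<in> U\<close> by blast
  let ?g = "\<lambda>t i l k. frame_matrix (z + t *s D) (\<alpha> (z + t *s D)) $ i $ l $ k"
  let ?c = "\<lambda>i t. 1 / ?g t i 1 1"
  let ?y = "\<lambda>i t. (?g t i 1 1 * Y $ i - ?g t i 1 2) / ?g t i 2 2"
  have "frame_matrix z (\<alpha> z) = shear s"
    unfolding at_z by (rule frame_matrix_std_frame_mult[OF z shear_in_borel_group])
  then have g0: "frame_matrix (z + 0 *s D) (\<alpha> (z + 0 *s D)) = shear s"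
    and shear_nth: "shear s $ i $ 1 $ 1 = 1" "shear s $ i $ 1 $ 2 = - s $ i" "shear s $ i $ 2 $ 2 = 1" for i
    by (simp_all add: vector_smult_lzero shear_def)
  have g': "((\<lambda>t. ?g t i l k) has_field_derivative g' i l k) (at 0)" for i l k
    unfolding g'_def
    by (rule holo_on_has_field_derivative_along_line[OF local_frame_frame_matrix_holo[OF \<alpha>] \<open>z \<in> U\<close>])
  have c': "(?c i has_field_derivative - g' i 1 1) (at 0)" for i
    using DERIV_divide[OF DERIV_const[of 1] g'[of i 1 1]] unfolding g0 shear_nth by simp
  have y': "(?y i has_field_derivative g' i 1 1 * Y $ i - g' i 1 2 - g' i 2 2 * (Y $ i + s $ i)) (at 0)" for i
    using DERIV_divide[OF DERIV_diff[OF DERIV_cmult_right[OF g'[of i 1 1], of "Y $ i"] g'[of i 1 2]] g'[of i 2 2]]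
    unfolding g0 shear_nth by (simp add: algebra_simps)
  have y0: "(\<chi> i. ?y i 0) = Y + s"
    unfolding g0 shear_nth by (simp add: vec_eq_iff)
  have P': "((\<lambda>t. f (z + t *s D) (std_frame (z + t *s D)) (\<chi> i. ?y i t)) has_field_derivative
      dir_deriv D (\<lambda>z'. f z' (std_frame z') (Y + s)) z
      + (\<Sum>i\<in>UNIV. (g' i 1 1 * Y $ i - g' i 1 2 - g' i 2 2 * (Y $ i + s $ i))
          * dir_deriv (axis i 1) (f z (std_frame z)) (Y + s))) (at 0)"
    using V_type_family_chain[of upper_half "\<lambda>z. f z (std_frame z)" \<nu> z ?y, OF section_family[OF assms(1) f]
        open_upper_half z y', of D]
    unfolding y0 by simp
  have w': "((\<lambda>t. weight_char \<kappa> (\<chi> i. ?c i t)) has_field_derivative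
      - (\<Sum>i\<in>UNIV. of_int (\<kappa> i) * g' i 1 1)) (at 0)"
    using weight_char_has_field_derivative[of ?c, OF c', of \<kappa>]
    unfolding g0 shear_nth by (simp add: weight_char_def sum_negf)
  have w0: "weight_char \<kappa> (\<chi> i. ?c i 0) = 1"
    unfolding g0 shear_nth by (simp add: weight_char_def)
  have near: "\<forall>\<^sub>F t in nhds 0. f (z + t *s D) (\<alpha> (z + t *s D)) Y
      = weight_char \<kappa> (\<chi> i. ?c i t) * f (z + t *s D) (std_frame (z + t *s D)) (\<chi> i. ?y i t)"
    using eventually_line_in_open[OF U(1) \<open>z \<in> U\<close>, of D]
  proof (rule eventually_mono)
    fix t assume "z + t *s D \<in> U"
    then have frame: "is_frame emb (\<alpha> (z + t *s D))" and upper: "z + t *s D \<in> upper_half"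
      using \<alpha> by (auto simp: local_frame_def)
    show "f (z + t *s D) (\<alpha> (z + t *s D)) Y
      = weight_char \<kappa> (\<chi> i. ?c i t) * f (z + t *s D) (std_frame (z + t *s D)) (\<chi> i. ?y i t)"
      by (subst frame_eq_std_frame_mult[OF assms(1) upper frame])
        (rule section_frame_mult[OF f upper is_frame_std_frame[OF assms(1) upper]
            frame_matrix_in_borel_group[OF assms(1) upper frame]])
  qed
  show ?thesis
    unfolding dir_deriv_def[of D "\<lambda>z'. f z' (\<alpha> z') Y"]
  proof (rule DERIV_imp_deriv, subst DERIV_cong_ev[OF refl near refl])
    show "((\<lambda>t. weight_char \<kappa> (\<chi> i. ?c i t) * f (z + t *s D) (std_frame (z + t *s D)) (\<chi> i. ?y i t))
      has_field_derivative dir_deriv D (\<lambda>z'. f z' (std_frame z') (Y + s)) z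
        - (\<Sum>i\<in>UNIV. of_int (\<kappa> i) * g' i 1 1) * f z (std_frame z) (Y + s)
        + (\<Sum>i\<in>UNIV. (g' i 1 1 * Y $ i - g' i 1 2 - g' i 2 2 * (Y $ i + s $ i))
          * dir_deriv (axis i 1) (f z (std_frame z)) (Y + s))) (at 0)"
      using DERIV_mult[OF w' P'] unfolding w0 y0 by (simp add: vector_smult_lzero algebra_simps)
  qed
qed

text \<open>
  The terms with \<open>g'\<close> in the derivative of the section cancel those in the connection matrix. What
  survives is the action of \<open>g\<^sup>-\<^sup>1 n g\<close> with \<open>g = shear s\<close> and \<open>n = \<Sum>\<^sub>i D\<^sub>i \<mu>\<^sub>i\<^sup>-\<close>; since acting by \<open>g\<^sup>-\<^sup>1\<close> translates
  polynomials by \<open>s\<close>, this is the action of \<open>n\<close> on \<open>P\<^sub>z\<close>, evaluated at \<open>Y + s\<close>.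
\<close>

lemma nabla_V_at_shear:
  fixes emb :: "'n::finite \<Rightarrow> 'f::field_char_0 \<Rightarrow> real" and D :: "complex^'n"
  assumes "totally_real_field emb" and f: "section_on_Y emb N \<kappa> \<nu> f" and z: "z \<in> upper_half"
  shows "nabla_V emb \<kappa> D f z (frame_mult (std_frame z) (shear s))
    = (\<lambda>Y. dir_deriv D (\<lambda>z'. f z' (std_frame z') (Y + s)) z
          + (\<Sum>i\<in>UNIV. D $ i * mu_minus \<kappa> i (f z (std_frame z)) (Y + s)))" (is "_ = ?R")
proof -
  let ?P = "f z (std_frame z)"
  have independent: "(\<lambda>Y. dir_deriv D (\<lambda>z'. f z' (\<alpha> z') Y) z + g_act \<kappa> (conn_matrix D \<alpha> z) (f z (\<alpha> z)) Y) = ?R"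
    if \<alpha>: "local_frame emb U \<alpha>" and "z \<in> U" and at_z: "\<alpha> z = frame_mult (std_frame z) (shear s)" for U \<alpha>
  proof
    fix Y
    define g' where "g' = (\<lambda>i l k. dir_deriv D (\<lambda>z'. frame_matrix z' (\<alpha> z') $ i $ l $ k) z)"
    define p where "p = ?P (Y + s)"
    define d where "d = (\<lambda>i. dir_deriv (axis i 1) ?P (Y + s))"
    define k where "k = (\<lambda>i. complex_of_int (\<kappa> i))"
    have f\<alpha>: "f z (\<alpha> z) = (\<lambda>Y. ?P (Y + s))"
      unfolding at_z by (rule ext) (rule section_at_shear[OF assms])
    have holo_s: "holo_on (\<lambda>Y. ?P (Y + s)) UNIV"
    proof -
      have "is_frame emb (\<alpha> z)"
        using \<alpha> \<open>z \<in> U\<close> by (simp add: local_frame_def)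
      then have "f z (\<alpha> z) \<in> V_type \<nu>"
        using f z by (simp add: section_on_Y_def)
      then show ?thesis
        unfolding f\<alpha> by (rule V_type_imp_holo)
    qed
    have deriv: "dir_deriv D (\<lambda>z'. f z' (\<alpha> z') Y) z = dir_deriv D (\<lambda>z'. f z' (std_frame z') (Y + s)) z
      - (\<Sum>i\<in>UNIV. k i * g' i 1 1) * p
      + (\<Sum>i\<in>UNIV. (g' i 1 1 * Y $ i - g' i 1 2 - g' i 2 2 * (Y $ i + s $ i)) * d i)"
      unfolding p_def d_def g'_def k_def by (rule section_dir_deriv_at_shear[OF assms(1) f \<alpha> \<open>z \<in> U\<close> at_z])
    have act: "g_act \<kappa> (conn_matrix D \<alpha> z) (f z (\<alpha> z)) Y
      = (\<Sum>i\<in>UNIV. k i * (g' i 1 1 + s $ i * D $ i)) * p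
      + (\<Sum>i\<in>UNIV. (g' i 1 2 + s $ i * (g' i 2 2 - s $ i * D $ i) + Y $ i * (g' i 2 2 - s $ i * D $ i)
           - Y $ i * (g' i 1 1 + s $ i * D $ i)) * d i)
      + (\<Sum>i\<in>UNIV. D $ i * (k i * Y $ i * p - (Y $ i)\<^sup>2 * d i))"
      unfolding f\<alpha> g_act_def q_act_eq[OF holo_s] mu_minus_def dir_deriv_translate
        conn_matrix_at_shear[OF assms(1) \<alpha> \<open>z \<in> U\<close> at_z, of D, folded g'_def] p_def d_def k_def
      by (simp add: upper_part_def g'_def)
    show "dir_deriv D (\<lambda>z'. f z' (\<alpha> z') Y) z + g_act \<kappa> (conn_matrix D \<alpha> z) (f z (\<alpha> z)) Y = ?R Y"
    proof -
      \<comment> \<open>For every \<open>i\<close> the terms with \<open>g'\<close> cancel and the squares in \<open>Y\<^sub>i + s\<^sub>i\<close> complete.\<close>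
      have total: "- (\<Sum>i\<in>UNIV. k i * g' i 1 1) * p
          + (\<Sum>i\<in>UNIV. (g' i 1 1 * Y $ i - g' i 1 2 - g' i 2 2 * (Y $ i + s $ i)) * d i)
          + ((\<Sum>i\<in>UNIV. k i * (g' i 1 1 + s $ i * D $ i)) * p
          + (\<Sum>i\<in>UNIV. (g' i 1 2 + s $ i * (g' i 2 2 - s $ i * D $ i) + Y $ i * (g' i 2 2 - s $ i * D $ i)
               - Y $ i * (g' i 1 1 + s $ i * D $ i)) * d i)
          + (\<Sum>i\<in>UNIV. D $ i * (k i * Y $ i * p - (Y $ i)\<^sup>2 * d i)))
        = (\<Sum>i\<in>UNIV. D $ i * (k i * (Y $ i + s $ i) * p - (Y $ i + s $ i)\<^sup>2 * d i))"
        unfolding sum_distrib_right sum_negf[symmetric] sum.distrib[symmetric]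
        by (intro sum.cong refl) (simp add: algebra_simps power2_eq_square)
      have R: "?R Y = dir_deriv D (\<lambda>z'. f z' (std_frame z') (Y + s)) z
          + (\<Sum>i\<in>UNIV. D $ i * (k i * (Y $ i + s $ i) * p - (Y $ i + s $ i)\<^sup>2 * d i))"
        by (simp add: mu_minus_def p_def d_def k_def)
      show ?thesis
        unfolding deriv act R total[symmetric]
        by (simp only: diff_conv_add_uminus mult_minus_left add.assoc)
    qed
  qed
  have frame: "local_frame emb upper_half (\<lambda>z. frame_mult (std_frame z) (shear s))"
    by (rule local_frame_std_frame_mult[OF assms(1) shear_in_borel_group])
  show ?thesis
    unfolding nabla_V_def
  proof (rule the_equality)
    show "\<forall>U \<alpha>. local_frame emb U \<alpha> \<and> z \<in> U \<and> \<alpha> z = frame_mult (std_frame z) (shear s) \<longrightarrow>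
      ?R = (\<lambda>Y. dir_deriv D (\<lambda>z'. f z' (\<alpha> z') Y) z + g_act \<kappa> (conn_matrix D \<alpha> z) (f z (\<alpha> z)) Y)"
      using independent by auto
  next
    fix R
    assume "\<forall>U \<alpha>. local_frame emb U \<alpha> \<and> z \<in> U \<and> \<alpha> z = frame_mult (std_frame z) (shear s) \<longrightarrow>
      R = (\<lambda>Y. dir_deriv D (\<lambda>z'. f z' (\<alpha> z') Y) z + g_act \<kappa> (conn_matrix D \<alpha> z) (f z (\<alpha> z)) Y)"
    from this[rule_format, of upper_half "\<lambda>z. frame_mult (std_frame z) (shear s)"] frame z
    show "R = ?R"
      using independent[OF frame z] by simp
  qed
qed

section \<open>Kodaira--Spencer coordinates and the Maass--Shimura operator\<close>

text \<open>
  The normalization of the Kodaira--Spencer isomorphism: \<open>dw\<^sub>j\<^sup>\<otimes>\<^sup>2\<close> corresponds to \<open>dz\<^sub>j\<close>, because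
  \<open>\<nabla>(dw\<^sub>j) = \<beta>\<^sub>j dz\<^sub>j\<close> and \<open>dw\<^sub>j\<close> pairs to one with \<open>\<beta>\<^sub>j\<close>.
\<close>

lemma ks_inverse_dw:
  assumes "z \<in> upper_half"
  shows "ks_inverse j z (\<lambda>v. v $ j) D = D $ j"
proof -
  have "gauss_manin D (\<lambda>_ v. v $ j) z v = of_real (coord_b z v $ j) * D $ j" for v
    unfolding gauss_manin_def dir_deriv_def per_def
    by (intro DERIV_imp_deriv) (auto intro!: derivative_eq_intros)
  then show ?thesis
    using upper_half_Im_nonzero[OF assms, of j]
    by (simp add: ks_inverse_def pol_pairing_def coord_b_def axis_def)
qed

lemma ks_coord_dw:
  assumes "z \<in> upper_half" and "\<And>j. \<alpha> j 1 = (\<lambda>v. v $ j)" and "\<And>D. \<theta> D = (\<Sum>j\<in>UNIV. D $ j * c j)"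
  shows "ks_coord i z \<alpha> \<theta> = c i"
proof -
  have "(THE c'. \<forall>D. \<theta> D = (\<Sum>j\<in>UNIV. c' j * ks_inverse j z (\<alpha> j 1) D)) = c"
    unfolding assms(2,3) ks_inverse_dw[OF assms(1)]
  proof (rule the_equality)
    show "\<forall>D. (\<Sum>j\<in>UNIV. D $ j * c j) = (\<Sum>j\<in>UNIV. c j * D $ j)"
      by (simp add: mult.commute)
  next
    fix c' assume c': "\<forall>D. (\<Sum>j\<in>UNIV. D $ j * c j) = (\<Sum>j\<in>UNIV. c' j * D $ j)"
    show "c' = c"
    proof
      fix j
      show "c' j = c j"
        using c'[rule_format, of "axis j 1"] by (simp add: axis_def if_distrib if_distribR cong: if_cong)
    qed
  qed
  then show ?thesis
    by (simp add: ks_coord_def)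
qed

text \<open>
  The first half of the frame used by \<open>\<phi>\<close> is \<open>dw\<close>, and therefore \<open>\<nabla>\<^sub>i\<close> takes the coefficient of \<open>dz\<^sub>i\<close>. The
  value at \<open>Y = 0\<close> after a shear by \<open>s\<close> is a value at \<open>Y = s\<close>.
\<close>

lemma phi_nabla_comp:
  assumes "totally_real_field emb" and f: "section_on_Y emb N \<kappa> \<nu> f" and z: "z \<in> upper_half"
  shows "phi_map (nabla_comp emb \<kappa> i f) z
     = dir_deriv (axis i 1) (\<lambda>z'. f z' (std_frame z') (s_fun z)) z
       + mu_minus \<kappa> i (f z (std_frame z)) (s_fun z)"
proof -
  have "ms_frame z j 1 = (\<lambda>v. v $ j)" for j
    by (simp add: ms_frame_def)
  moreover have "nabla_V emb \<kappa> D f z (ms_frame z) 0 = (\<Sum>j\<in>UNIV. D $ j *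
      (dir_deriv (axis j 1) (\<lambda>z'. f z' (std_frame z') (s_fun z)) z
       + mu_minus \<kappa> j (f z (std_frame z)) (s_fun z)))" for D
    unfolding ms_frame_eq_shear[OF z] nabla_V_at_shear[OF assms]
    using dir_deriv_eq_sum_axis[OF section_family(2)[OF assms(1) f] z, of D "s_fun z"]
    by (simp add: distrib_left sum.distrib)
  ultimately show ?thesis
    unfolding phi_map_def nabla_comp_def by (rule ks_coord_dw[OF z])
qed

lemma phi_map_eq:
  assumes "totally_real_field emb" and f: "section_on_Y emb N \<kappa> \<nu> f" and z: "z \<in> upper_half"
  shows "phi_map f z = f z (std_frame z) (s_fun z)"
  using section_at_shear[OF assms, of "s_fun z" 0] by (simp add: phi_map_def ms_frame_eq_shear[OF z])

text \<open>
  Near \<open>z\<close> the function in the Maass--Shimura operator is \<open>\<kappa>(s\<^sup>-\<^sup>1) P\<^sub>z(s(z))\<close>. It is not holomorphic, but the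
  Wirtinger derivative uses only its restrictions to the real lines \<open>z\<^sub>\<sigma> + t w\<close> with \<open>w = 1\<close> and \<open>w = \<i>\<close>. Along
  such a line \<open>1/s\<^sub>\<sigma> = z\<^sub>\<sigma> - cnj z\<^sub>\<sigma> + t (w - cnj w)\<close> makes sense for complex \<open>t\<close>, and the restriction is the
  restriction to real \<open>t\<close> of a holomorphic function, to which the complex chain rule applies.
\<close>

lemma maass_shimura_phi:
  fixes emb :: "'n::finite \<Rightarrow> 'f::field_char_0 \<Rightarrow> real"
  assumes "totally_real_field emb" and f: "section_on_Y emb N \<kappa> \<nu> f" and z: "z \<in> upper_half"
  shows "maass_shimura \<kappa> \<sigma> (phi_map f) z
     = dir_deriv (axis \<sigma> 1) (\<lambda>z'. f z' (std_frame z') (s_fun z)) z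
       + mu_minus \<kappa> \<sigma> (f z (std_frame z)) (s_fun z)"
proof -
  define s where "s = s_fun z"
  define d where "d = (\<lambda>j. z $ j - cnj (z $ j))"
  define W where "W = weight_char \<kappa> (\<chi> j. d j)"
  define p where "p = f z (std_frame z) s"
  define p_z where "p_z = dir_deriv (axis \<sigma> 1) (\<lambda>z'. f z' (std_frame z') s) z"
  define p_Y where "p_Y = dir_deriv (axis \<sigma> 1) (f z (std_frame z)) s"
  define H where "H = (\<lambda>z'. weight_char \<kappa> (\<chi> j. inverse (s_fun z' $ j)) * phi_map f z')"
  have d_nz: "d j \<noteq> 0" for j
    using upper_half_Im_nonzero[OF z, of j] by (simp add: d_def complex_eq_iff)
  have s_d: "s $ j = 1 / d j" for j
    by (simp add: s_def d_def s_fun_def)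
  have curve: "((\<lambda>t::real. H (z + axis \<sigma> (of_real t * w))) has_vector_derivative
      W * (of_int (\<kappa> \<sigma>) * (w - cnj w) * s $ \<sigma> * p + w * p_z - (w - cnj w) * (s $ \<sigma>)\<^sup>2 * p_Y)) (at 0)"
    (is "(_ has_vector_derivative ?H') _") for w
  proof -
    \<comment> \<open>\<open>?c j t\<close> is the continuation to complex \<open>t\<close> of \<open>1/s\<^sub>j\<close> along the line.\<close>
    let ?e = "\<lambda>j. if j = \<sigma> then w - cnj w else 0"
    let ?c = "\<lambda>j t. d j + t * ?e j"
    let ?y = "\<lambda>j t. 1 / ?c j t"
    let ?D = "axis \<sigma> w"
    define G where "G = (\<lambda>t::real. weight_char \<kappa> (\<chi> j. ?c j (of_real t)) * f (z + of_real t *s ?D)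
        (std_frame (z + of_real t *s ?D)) (\<chi> j. ?y j (of_real t)))"
    have c': "(?c j has_field_derivative ?e j) (at 0)" for j
      by (rule derivative_eq_intros refl | simp)+
    have y': "(?y j has_field_derivative - ?e j * (s $ j)\<^sup>2) (at 0)" for j
      by (rule derivative_eq_intros refl | simp add: d_nz s_d power2_eq_square)+
    have y0: "(\<chi> j. ?y j 0) = s"
      by (simp add: vec_eq_iff s_d)
    have D: "axis \<sigma> w = w *s axis \<sigma> 1"
      by (simp add: vec_eq_iff axis_def)
    have p_w: "dir_deriv ?D (\<lambda>z'. f z' (std_frame z') s) z = w * p_z"
      using dir_deriv_eq_sum_axis[OF section_family(2)[OF assms(1) f] z, of "axis \<sigma> w" s]
      by (simp add: p_z_def axis_def if_distrib if_distribR cong: if_cong)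
    have P': "((\<lambda>t. f (z + t *s ?D) (std_frame (z + t *s ?D)) (\<chi> j. ?y j t)) has_field_derivative
        w * p_z - (w - cnj w) * (s $ \<sigma>)\<^sup>2 * p_Y) (at 0)"
    proof -
      have "(\<Sum>j\<in>UNIV. - ?e j * (s $ j)\<^sup>2 * dir_deriv (axis j 1) (f z (std_frame z)) s)
          = (\<Sum>j\<in>UNIV. if j = \<sigma> then - ((w - cnj w) * (s $ \<sigma>)\<^sup>2 * p_Y) else 0)"
        by (intro sum.cong) (auto simp: p_Y_def algebra_simps)
      then have sum_Y: "(\<Sum>j\<in>UNIV. - ?e j * (s $ j)\<^sup>2 * dir_deriv (axis j 1) (f z (std_frame z)) s)
          = - ((w - cnj w) * (s $ \<sigma>)\<^sup>2 * p_Y)"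
        by simp
      show ?thesis
        using V_type_family_chain[of upper_half "\<lambda>z. f z (std_frame z)" \<nu> z ?y, OF section_family[OF assms(1) f]
          open_upper_half z y', of ?D]
        unfolding y0 p_w sum_Y by simp
    qed
    have w': "((\<lambda>t. weight_char \<kappa> (\<chi> j. ?c j t)) has_field_derivative
        W * (of_int (\<kappa> \<sigma>) * (w - cnj w) * s $ \<sigma>)) (at 0)"
    proof -
      have "(\<Sum>j\<in>UNIV. of_int (\<kappa> j) * ?e j / ?c j 0)
          = (\<Sum>j\<in>UNIV. if j = \<sigma> then of_int (\<kappa> \<sigma>) * (w - cnj w) * s $ \<sigma> else 0)"
        by (intro sum.cong) (auto simp: s_d)
      then show ?thesis
        using weight_char_has_field_derivative[of ?c, OF c', of \<kappa>] d_nz by (simp add: W_def)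
    qed
    have "((\<lambda>t. weight_char \<kappa> (\<chi> j. ?c j t) * f (z + t *s ?D) (std_frame (z + t *s ?D)) (\<chi> j. ?y j t))
        has_field_derivative ?H') (at (of_real 0))"
      using DERIV_mult[OF w' P'] unfolding y0
      by (simp add: W_def p_def vector_smult_lzero algebra_simps)
    then have G': "(G has_vector_derivative ?H') (at 0)"
      unfolding G_def by (rule has_vector_derivative_real_field)
    have near: "\<forall>\<^sub>F t in nhds 0. H (z + axis \<sigma> (of_real t * w)) = G t"
    proof -
      have "filterlim complex_of_real (nhds 0) (nhds 0)"
        using tendsto_of_real[OF filterlim_ident, of 0] by simp
      then have "\<forall>\<^sub>F t in nhds (0::real). z + of_real t *s ?D \<in> upper_half"
        using eventually_line_in_open[OF open_upper_half z, of ?D] by (rule eventually_compose_filterlim[rotated])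
      then show ?thesis
      proof (rule eventually_mono)
        fix t :: real
        let ?z = "z + of_real t *s ?D"
        assume zt: "?z \<in> upper_half"
        have eq: "z + axis \<sigma> (of_real t * w) = ?z"
          by (simp add: vec_eq_iff axis_def)
        have "?z $ j - cnj (?z $ j) = ?c j (of_real t)" for j
          by (simp add: axis_def d_def algebra_simps)
        then have s: "s_fun ?z = (\<chi> j. ?y j (of_real t))"
          by (simp only: s_fun_def)
        show "H (z + axis \<sigma> (of_real t * w)) = G t"
          unfolding eq H_def G_def phi_map_eq[OF assms(1) f zt] s by simp
      qed
    qed
    have "((\<lambda>t::real. H (z + axis \<sigma> (of_real t * w))) has_vector_derivative ?H') (at 0)
        \<longleftrightarrow> (G has_vector_derivative ?H') (at 0)"
    proof (rule has_vector_derivative_cong_ev)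
      show "\<forall>\<^sub>F t in nhds 0. t \<in> UNIV \<longrightarrow> H (z + axis \<sigma> (of_real t * w)) = G t"
        using near by simp
      show "H (z + axis \<sigma> (of_real 0 * w)) = G 0"
        by (rule eventually_nhds_x_imp_x[OF near])
    qed
    with G' show ?thesis
      by blast
  qed
  have "wirtinger \<sigma> H z = W * (of_int (\<kappa> \<sigma>) * s $ \<sigma> * p + p_z - (s $ \<sigma>)\<^sup>2 * p_Y)"
  proof -
    have 1: "vector_derivative (\<lambda>t::real. H (z + axis \<sigma> (of_real t))) (at 0) = W * p_z"
      using vector_derivative_at[OF curve[of 1]] by simp
    have 2: "vector_derivative (\<lambda>t::real. H (z + axis \<sigma> (\<i> * of_real t))) (at 0)
        = \<i> * (W * (2 * of_int (\<kappa> \<sigma>) * s $ \<sigma> * p + p_z - 2 * (s $ \<sigma>)\<^sup>2 * p_Y))"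
      using vector_derivative_at[OF curve[of \<i>]]
      by (simp add: mult.commute[of \<i> "of_real _"]) (simp add: algebra_simps)
    have "wirtinger \<sigma> H z
        = (W * p_z + W * (2 * of_int (\<kappa> \<sigma>) * s $ \<sigma> * p + p_z - 2 * (s $ \<sigma>)\<^sup>2 * p_Y)) / 2"
      unfolding wirtinger_def 1 2 by simp
    also have "\<dots> = W * (of_int (\<kappa> \<sigma>) * s $ \<sigma> * p + p_z - (s $ \<sigma>)\<^sup>2 * p_Y)"
      by (simp add: field_simps)
    finally show ?thesis .
  qed
  moreover have "weight_char \<kappa> s * W = 1"
    using d_nz by (simp add: weight_char_def W_def s_d flip: prod.distrib power_int_mult_distrib)
  ultimately have "maass_shimura \<kappa> \<sigma> (phi_map f) z = of_int (\<kappa> \<sigma>) * s $ \<sigma> * p + p_z - (s $ \<sigma>)\<^sup>2 * p_Y"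
    unfolding maass_shimura_def H_def s_def[symmetric] by (simp flip: mult.assoc)
  then show ?thesis
    by (simp add: mu_minus_def p_def p_z_def p_Y_def s_def)
qed

theorem theorem3p5p3:
  fixes emb :: "'n::finite \<Rightarrow> 'f::field_char_0 \<Rightarrow> real"
    and N :: nat
    and fan :: "'f^2^2 \<Rightarrow> 'f set set"
    and \<kappa> :: "'n \<Rightarrow> int"
    and \<nu> :: "'n \<Rightarrow> nat"
    and \<sigma> :: 'n
  assumes "totally_real_field emb"
    and "N \<ge> 5"
    and "projective_toroidal_data emb N fan"
  shows "\<forall>f\<in>global_sections emb N fan \<kappa> \<nu>. \<forall>z\<in>upper_half.
           maass_shimura \<kappa> \<sigma> (phi_map f) z = phi_map (nabla_comp emb \<kappa> \<sigma> f) z"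
proof (intro ballI)
  fix f and z :: "complex^'n"
  assume "f \<in> global_sections emb N fan \<kappa> \<nu>" and z: "z \<in> upper_half"
  then have f: "section_on_Y emb N \<kappa> \<nu> f"
    by (simp add: global_sections_def)
  show "maass_shimura \<kappa> \<sigma> (phi_map f) z = phi_map (nabla_comp emb \<kappa> \<sigma> f) z"
    using maass_shimura_phi[OF assms(1) f z] phi_nabla_comp[OF assms(1) f z] by simp
qed

end
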